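(* Let $\lambda=(\lambda_1\ge\dots\ge\lambda_n\ge0)$ be a partition and let $\sigma_\lambda$ be the grassmannian permutation of shape $\lambda$ with a unique descent at position $n$. Write $X_n=(x_1,\dots,x_n)$. Then (A) $$\mathfrak{G}^{(\beta)}_{\sigma_\lambda}(X_n)=\det\bigl|h^{(\beta)}_{\lambda_j+i,\,j}(X_n)\bigr|_{1\le i,j\le n}=\frac{\det\bigl|x_i^{\lambda_j+n-j}(1+\beta x_i)^{j-1}\bigr|_{1\le i,j\le n}}{\prod_{1\le i<j\le n}(x_i-x_j)},$$ where for integers $m$, $k\ge1$ and a set of variables $X$ $$h^{(\beta)}_{m,k}(X)=\sum_{a=0}^{k-1}\binom{k-1}{a}h_{m-k+a}(X)\beta^a,$$ and $h_r(X)$ is the complete homogeneous symmetric polynomial of degree $r$ ($h_r=0$ for $r<0$). (B) $$\mathfrak{G}^{(\beta)}_{\sigma_\lambda}(X,Y)=\frac{\det\Bigl|\prod_{a=1}^{\lambda_j+n-j}(x_i+y_a+\beta x_iy_a)\,(1+\beta x_i)^{j-1}\Bigr|_{1\le i,j\le n}}{\prod_{1\le i<j\le n}(x_i-x_j)}.$$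
   Context: The grassmannian permutation $\sigma_\lambda\in\mathbb{S}_N$ ($N$ large) is given by $\sigma_\lambda(i)=i+\lambda_{n+1-i}$ for $1\le i\le n$ and $\sigma_\lambda(n+1)<\sigma_\lambda(n+2)<\cdots$. Let $\beta$ be an indeterminate. $\mathrm{IdC}_N(\beta)$ is the associative $\mathbb{Z}[\beta]$-algebra with generators $e_1,\dots,e_{N-1}$ and relations $e_ie_j=e_je_i$ if $|i-j|\ge2$, $e_ie_je_i=e_je_ie_j$ if $|i-j|=1$, $e_i^2=\beta e_i$. For $w\in\mathbb{S}_N$ put $e_w=e_{i_1}\cdots e_{i_\ell}$ for any reduced word $w=s_{i_1}\cdots s_{i_\ell}$ ($s_i=(i,i+1)$, permutations composed from right to left); the $e_w$ form a $\mathbb{Z}[\beta]$-basis. With commuting variables $x_i,y_i$ commuting with all $e_j$, put $h_i(x)=1+xe_i$, $x\oplus y=x+y+\beta xy$, $A_i(x)=h_{N-1}(x)\cdots h_i(x)$. The $\beta$-Grothendieck polynomials are defined by $A_1(x_1)\cdots A_{N-1}(x_{N-1})=\sum_{w\in\mathbb{S}_N}\mathfrak{G}_w^{(\beta)}(X)e_w$, and the double $\beta$-Grothendieck polynomials by $$\prod_{i=1,2,\dots,N-1}\ \prod_{j=N-i,\dots,1}h_{i+j-1}(x_i\oplus y_j)=\sum_{w\in\mathbb{S}_N}\mathfrak{G}_w^{(\beta)}(X,Y)e_w$$ (factors left to right in the indicated order). They are stable under $\mathbb{S}_N\subset\mathbb{S}_{N+1}$. *)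

theory Defs
  imports
    "HOL-Library.Poly_Mapping"
    "HOL-Library.Multiset"
    "HOL-Combinatorics.Permutations"
    "HOL-Algebra.QuotRing"
    "HOL-Computational_Algebra.Fraction_Field"
    "HOL-Computational_Algebra.Polynomial_Factorial"
    "Jordan_Normal_Form.Determinant"
begin

hide_const (open) Multiset.mult

section \<open>The polynomial ring and its fraction field\<close>

datatype var = Beta | VX nat | VY nat

text \<open>Any linear order on the variables will do; it is only needed for the type class instance
  stating that the polynomial ring is an integral domain.\<close>

fun var_code :: "var \<Rightarrow> nat" where
  "var_code Beta = 0"
| "var_code (VX i) = 2 * i + 1"
| "var_code (VY i) = 2 * i + 2"

lemma var_code_inject: "var_code u = var_code v \<Longrightarrow> u = v"
  by (cases u; cases v; simp; presburger)

instantiation var :: linorder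
begin

definition less_eq_var :: "var \<Rightarrow> var \<Rightarrow> bool" where
  "less_eq_var u v \<longleftrightarrow> var_code u \<le> var_code v"

definition less_var :: "var \<Rightarrow> var \<Rightarrow> bool" where
  "less_var u v \<longleftrightarrow> var_code u < var_code v"

instance
  by standard (auto simp: less_eq_var_def less_var_def intro: var_code_inject)

end

text \<open>The ring $\mathbf{Z}[\beta, x_i, y_i]$: finitely supported families of integers indexed by
  monomials, a monomial being a finitely supported family of exponents. Multiplication on
  \<open>poly_mapping\<close> is convolution.\<close>

type_synonym gpoly = "(var \<Rightarrow>\<^sub>0 nat) \<Rightarrow>\<^sub>0 int"

definition pvar :: "var \<Rightarrow> gpoly" where
  "pvar v = Poly_Mapping.single (Poly_Mapping.single v 1) 1"

abbreviation beta :: gpoly where "beta \<equiv> pvar Beta"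
abbreviation xvar :: "nat \<Rightarrow> gpoly" where "xvar i \<equiv> pvar (VX i)"
abbreviation yvar :: "nat \<Rightarrow> gpoly" where "yvar i \<equiv> pvar (VY i)"

section \<open>Permutations\<close>

text \<open>The symmetric group on $\{1,\dots,N\}$ is \<open>{w. w permutes {1..N}}\<close>; composition is
  from right to left.\<close>

definition word_perm :: "nat list \<Rightarrow> nat \<Rightarrow> nat" where
  "word_perm is = foldr (\<circ>) (map (\<lambda>i. transpose i (i + 1)) is) id"

definition reduced_word :: "nat \<Rightarrow> (nat \<Rightarrow> nat) \<Rightarrow> nat list \<Rightarrow> bool" where
  "reduced_word N w is \<longleftrightarrow> set is \<subseteq> {1..<N} \<and> word_perm is = w \<and>
     (\<forall>js. set js \<subseteq> {1..<N} \<and> word_perm js = w \<longrightarrow> length is \<le> length js)"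

text \<open>A sequence $\lambda_1,\dots,\lambda_n$ is given by the values at $1,\dots,n$ of a function on
  the natural numbers; the other values are irrelevant.\<close>

definition is_partition :: "nat \<Rightarrow> (nat \<Rightarrow> nat) \<Rightarrow> bool" where
  "is_partition n lam \<longleftrightarrow> (\<forall>i j. 1 \<le> i \<and> i \<le> j \<and> j \<le> n \<longrightarrow> lam j \<le> lam i)"

text \<open>This is meaningful for partitions with $N \ge n + \lambda_1$.\<close>

definition grassmannian_perm :: "nat \<Rightarrow> nat \<Rightarrow> (nat \<Rightarrow> nat) \<Rightarrow> nat \<Rightarrow> nat" where
  "grassmannian_perm N n lam = (THE w. w permutes {1..N} \<and>
     (\<forall>i\<in>{1..n}. w i = i + lam (n + 1 - i)) \<and> strict_mono_on {n<..N} w)"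

section \<open>The algebra $\mathrm{IdC}_N(\beta)$\<close>

text \<open>Words in the generators $e_i$. The monoid operation (concatenation) is written additively,
  so that \<open>fword \<Rightarrow>\<^sub>0 'a\<close> with its convolution product is the free associative algebra over
  \<open>'a\<close> on $e_0, e_1, e_2, \dots$.\<close>

datatype fword = FWord (letters: "nat list")

instantiation fword :: monoid_add
begin

definition zero_fword :: fword where "0 = FWord []"

definition plus_fword :: "fword \<Rightarrow> fword \<Rightarrow> fword" where
  "u + v = FWord (letters u @ letters v)"

instance
  by standard (simp_all add: zero_fword_def plus_fword_def)

end

text \<open>The coefficient ring \<open>'a\<close> stands for $\mathbf{Z}[\beta]$ together with whatever commuting
  variables are adjoined to it; these commute with the generators because they are scalars.
  The carrier of \<open>free_algebra N\<close> only uses the generators $e_1,\dots,e_{N-1}$.\<close>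

definition free_algebra :: "nat \<Rightarrow> (fword \<Rightarrow>\<^sub>0 'a::comm_ring_1) ring" where
  "free_algebra N =
     \<lparr>carrier = {p. \<forall>u\<in>Poly_Mapping.keys p. set (letters u) \<subseteq> {1..<N}},
      mult = (*), one = 1, zero = 0, add = (+)\<rparr>"

definition scalar :: "'a::comm_ring_1 \<Rightarrow> fword \<Rightarrow>\<^sub>0 'a" where
  "scalar c = Poly_Mapping.single 0 c"

definition gen :: "nat \<Rightarrow> fword \<Rightarrow>\<^sub>0 'a::comm_ring_1" where
  "gen i = Poly_Mapping.single (FWord [i]) 1"

definition IdC_relators :: "nat \<Rightarrow> 'a::comm_ring_1 \<Rightarrow> (fword \<Rightarrow>\<^sub>0 'a) set" where
  "IdC_relators N \<beta> =
     {gen i * gen j - gen j * gen i | i j.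
        i \<in> {1..<N} \<and> j \<in> {1..<N} \<and> \<bar>int i - int j\<bar> \<ge> 2} \<union>
     {gen i * gen j * gen i - gen j * gen i * gen j | i j.
        i \<in> {1..<N} \<and> j \<in> {1..<N} \<and> \<bar>int i - int j\<bar> = 1} \<union>
     {gen i * gen i - scalar \<beta> * gen i | i. i \<in> {1..<N}}"

definition IdC_ideal :: "nat \<Rightarrow> 'a::comm_ring_1 \<Rightarrow> (fword \<Rightarrow>\<^sub>0 'a) set" where
  "IdC_ideal N \<beta> = genideal (free_algebra N) (IdC_relators N \<beta>)"

definition IdC :: "nat \<Rightarrow> 'a::comm_ring_1 \<Rightarrow> (fword \<Rightarrow>\<^sub>0 'a) set ring" where
  "IdC N \<beta> = free_algebra N Quot IdC_ideal N \<beta>"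

text \<open>The quotient map from the free algebra onto \<^term>\<open>IdC N \<beta>\<close>.\<close>

definition IdC_class :: "nat \<Rightarrow> 'a::comm_ring_1 \<Rightarrow> (fword \<Rightarrow>\<^sub>0 'a) \<Rightarrow> (fword \<Rightarrow>\<^sub>0 'a) set" where
  "IdC_class N \<beta> p = a_r_coset (free_algebra N) (IdC_ideal N \<beta>) p"

text \<open>A representative of $e_w$ in the free algebra. Its class in \<^term>\<open>IdC N \<beta>\<close> does not
  depend on the chosen reduced word.\<close>

definition e_perm :: "nat \<Rightarrow> (nat \<Rightarrow> nat) \<Rightarrow> fword \<Rightarrow>\<^sub>0 'a::comm_ring_1" where
  "e_perm N w = prod_list (map gen (SOME is. reduced_word N w is))"

text \<open>The coordinates of the class of \<open>p\<close> with respect to the basis of all $e_w$.\<close>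

definition IdC_coords :: "nat \<Rightarrow> 'a::comm_ring_1 \<Rightarrow> (fword \<Rightarrow>\<^sub>0 'a) \<Rightarrow> (nat \<Rightarrow> nat) \<Rightarrow> 'a" where
  "IdC_coords N \<beta> p = (THE c. (\<forall>w. \<not> w permutes {1..N} \<longrightarrow> c w = 0) \<and>
     IdC_class N \<beta> p =
     IdC_class N \<beta> (\<Sum>w | w permutes {1..N}. scalar (c w) * e_perm N w))"

section \<open>Grothendieck polynomials\<close>

definition h_gen :: "nat \<Rightarrow> 'a::comm_ring_1 \<Rightarrow> fword \<Rightarrow>\<^sub>0 'a" where
  "h_gen i x = 1 + scalar x * gen i"

definition oplus :: "'a::comm_ring_1 \<Rightarrow> 'a \<Rightarrow> 'a \<Rightarrow> 'a" where
  "oplus \<beta> x y = x + y + \<beta> * x * y"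

definition A_fac :: "nat \<Rightarrow> nat \<Rightarrow> 'a::comm_ring_1 \<Rightarrow> fword \<Rightarrow>\<^sub>0 'a" where
  "A_fac N i x = prod_list (map (\<lambda>j. h_gen j x) (rev [i..<N]))"

definition groth :: "nat \<Rightarrow> 'a::comm_ring_1 \<Rightarrow> (nat \<Rightarrow> 'a) \<Rightarrow> (nat \<Rightarrow> nat) \<Rightarrow> 'a" where
  "groth N \<beta> x w = IdC_coords N \<beta> (prod_list (map (\<lambda>i. A_fac N i (x i)) [1..<N])) w"

definition double_groth ::
    "nat \<Rightarrow> 'a::comm_ring_1 \<Rightarrow> (nat \<Rightarrow> 'a) \<Rightarrow> (nat \<Rightarrow> 'a) \<Rightarrow> (nat \<Rightarrow> nat) \<Rightarrow> 'a" where
  "double_groth N \<beta> x y w = IdC_coords N \<beta>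
     (prod_list (map (\<lambda>i. prod_list (map (\<lambda>j. h_gen (i + j - 1) (oplus \<beta> (x i) (y j)))
                                         (rev [1..<N - i + 1])))
                     [1..<N])) w"

section \<open>Symmetric polynomials and determinants\<close>

text \<open>$h_r(x_1,\dots,x_n)$ as the sum of all monomials of degree $r$, a monomial being a multiset
  of indices. For $r < 0$ the sum is empty.\<close>

definition complete_hom :: "nat \<Rightarrow> (nat \<Rightarrow> 'a::comm_ring_1) \<Rightarrow> int \<Rightarrow> 'a" where
  "complete_hom n x r =
     (\<Sum>M | set_mset M \<subseteq> {1..n} \<and> int (size M) = r. \<Prod>i\<in>#M. x i)"

definition beta_complete_hom ::
    "nat \<Rightarrow> 'a::comm_ring_1 \<Rightarrow> (nat \<Rightarrow> 'a) \<Rightarrow> int \<Rightarrow> nat \<Rightarrow> 'a" where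
  "beta_complete_hom n \<beta> x m k =
     (\<Sum>a = 0..k - 1. of_nat ((k - 1) choose a) * complete_hom n x (m - int k + int a) * \<beta> ^ a)"

text \<open>The determinant of $(F(i,j))_{1 \le i,j \le n}$; library matrices are indexed from 0.\<close>

definition det1 :: "nat \<Rightarrow> (nat \<Rightarrow> nat \<Rightarrow> 'a::comm_ring_1) \<Rightarrow> 'a" where
  "det1 n F = det (mat n n (\<lambda>(i, j). F (i + 1) (j + 1)))"

definition vandermonde_prod :: "nat \<Rightarrow> (nat \<Rightarrow> 'a::comm_ring_1) \<Rightarrow> 'a" where
  "vandermonde_prod n x = (\<Prod>(i, j) | 1 \<le> i \<and> i < j \<and> j \<le> n. x i - x j)"

end

theory Submission
  imports Defs "HOL-Computational_Algebra.Formal_Power_Series"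
begin

text \<open>
  The proof computes the coefficients of the grassmannian $e_w$ in the defining product one factor at a
  time and keeps a determinant for them at every stage.

  First the coefficients have to be accessible. The generators act on functions of permutations as they
  act by left multiplication on coefficient vectors (\<open>hecke_op\<close>). These operators satisfy the relations of
  the algebra, so the defining ideal acts as zero; together with Matsumoto's theorem for words in the
  generators (\<open>gen_word_eq_of_reduced\<close>) this shows that the $e_w$ form a basis and that the coefficient of
  $e_w$ in $P$ is the value at $w^{-1}$ of $P$ applied to the function of $1$ (\<open>IdC_coords_eq\<close>).

  A factor $1 + z e_k$ adds to the coefficient of $e_w$ the value $z (c_{s_k w} + \beta c_w)$ if $s_k w < w$, and
  nothing otherwise. If $w$ is grassmannian with descent at $n$, so is $s_k w$ in the first case
  (\<open>grassmannian_descent\<close>). The grassmannian coefficients thus evolve on their own. Now think of the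
  determinant with columns $\varphi_i(w(n+1-j))\,(1 + \beta x_i)^{j-1}$. If
  $\varphi_i(k+1) = (x_i \ominus x_m)\,\varphi_i(k)$ for all $i$, and if nothing is changed except that
  $z\,(1 + \beta x_i)\,\varphi_i(k)/(1 + \beta x_m)$ is added to $\varphi_i(k+1)$, then the determinant follows the
  same rule (\<open>grass_det_step\<close>): when $k$ and $k+1$ are both among the first $n$ values of $w$, their columns are
  adjacent and the change is a column operation. The identity
  $x_i \oplus y = (x_i \ominus x_m) + (1 + \beta x_i)(x_m \oplus y)/(1 + \beta x_m)$ says that the functions \<open>entry\<close>
  change in this way under every factor of the product (\<open>represents_step\<close>). At the start they give the
  Vandermonde product for the identity and zero for the other grassmannian permutations
  (\<open>represents_delta\<close>), at the end the factorial powers $\prod_{a<s}(x_i \oplus y_a)$. This proves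
  \<open>double_groth_grassmannian\<close>.

  Setting $y = 0$ gives the quotient of determinants for the single polynomials. The determinant in the
  $h^{(\beta)}$ is obtained from it by factoring the numerator through the expansion of the powers of $x_i$
  in complete homogeneous polynomials (\<open>det1_beta_complete_hom\<close>).
\<close>

section \<open>The action on coefficient functions\<close>

text \<open>A linear combination \<open>f\<close> of the $e_w$ is stored as the function \<open>C\<close> with \<open>C (w\<inverse>)\<close> the
  coefficient of $e_w$; the inverse is used because left multiplication of $w$ by $s_k$ turns into
  precomposition of $w^{-1}$ with $s_k$, and $s_k w < w$ is the condition
  $w^{-1}(k+1) < w^{-1}(k)$. Since $e_k e_v$ is $e_{s_k v}$ if $s_k v > v$ and $\beta e_v$ otherwise, $e_w$
  occurs in $e_k f$ only for $s_k w < w$, and then receives the coefficient of $e_{s_k w}$ and $\beta$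
  times the coefficient of $e_w$. These operators satisfy the relations of the algebra on functions of
  arbitrary maps \<open>p\<close>.\<close>

definition hecke_op :: "'a::comm_ring_1 \<Rightarrow> nat \<Rightarrow> ((nat \<Rightarrow> nat) \<Rightarrow> 'a) \<Rightarrow> (nat \<Rightarrow> nat) \<Rightarrow> 'a" where
  "hecke_op \<beta> k C p =
     (if p (Suc k) < p k then C (p \<circ> transpose k (Suc k)) + \<beta> * C p else 0)"

lemma hecke_op_square: "hecke_op \<beta> k (hecke_op \<beta> k C) = (\<lambda>p. \<beta> * hecke_op \<beta> k C p)"
  by (rule ext) (auto simp: hecke_op_def)

lemma hecke_op_add: "hecke_op \<beta> k (\<lambda>p. C p + D p) = (\<lambda>p. hecke_op \<beta> k C p + hecke_op \<beta> k D p)"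
  by (rule ext) (auto simp: hecke_op_def algebra_simps)

lemma hecke_op_cmult: "hecke_op \<beta> k (\<lambda>p. c * C p) = (\<lambda>p. c * hecke_op \<beta> k C p)"
  by (rule ext) (auto simp: hecke_op_def algebra_simps)

lemma transpose_commute_far:
  assumes "i + 2 \<le> j"
  shows "transpose i (Suc i) \<circ> transpose j (Suc j) = transpose j (Suc j) \<circ> transpose i (Suc i)"
  using assms by (auto simp: fun_eq_iff transpose_def)

lemma hecke_op_commute:
  assumes "i + 2 \<le> j"
  shows "hecke_op \<beta> i (hecke_op \<beta> j C) = hecke_op \<beta> j (hecke_op \<beta> i C)"
proof (rule ext)
  fix p :: "nat \<Rightarrow> nat"
  have t: "transpose i (Suc i) \<circ> transpose j (Suc j) = transpose j (Suc j) \<circ> transpose i (Suc i)"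
    by (rule transpose_commute_far[OF assms])
  have t': "p \<circ> transpose i (Suc i) \<circ> transpose j (Suc j) = p \<circ> transpose j (Suc j) \<circ> transpose i (Suc i)"
    by (simp only: o_assoc[symmetric] t)
  have "transpose i (Suc i) j = j" "transpose i (Suc i) (Suc j) = Suc j"
    "transpose j (Suc j) i = i" "transpose j (Suc j) (Suc i) = Suc i"
    using assms by (auto simp: transpose_def)
  then show "hecke_op \<beta> i (hecke_op \<beta> j C) p = hecke_op \<beta> j (hecke_op \<beta> i C) p"
    by (simp add: hecke_op_def t' algebra_simps)
qed

lemma transpose_braid:
  "transpose i (Suc i) \<circ> transpose (Suc i) (Suc (Suc i)) \<circ> transpose i (Suc i) =
   transpose (Suc i) (Suc (Suc i)) \<circ> transpose i (Suc i) \<circ> transpose (Suc i) (Suc (Suc i))"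
  by (auto simp: fun_eq_iff transpose_def)

text \<open>Only the relative order of \<open>p i\<close>, \<open>p (i + 1)\<close>, \<open>p (i + 2)\<close> matters: both sides unfold to nested
  case distinctions on it, and agree in each case by the braid relation of the transpositions.\<close>

lemma hecke_op_braid:
  "hecke_op \<beta> i (hecke_op \<beta> (Suc i) (hecke_op \<beta> i C)) =
   hecke_op \<beta> (Suc i) (hecke_op \<beta> i (hecke_op \<beta> (Suc i) C))"
proof (rule ext)
  fix p :: "nat \<Rightarrow> nat"
  define s where "s = transpose i (Suc i)"
  define t where "t = transpose (Suc i) (Suc (Suc i))"
  have b: "s \<circ> t \<circ> s = t \<circ> s \<circ> t" unfolding s_def t_def by (rule transpose_braid)
  have b': "p \<circ> s \<circ> t \<circ> s = p \<circ> t \<circ> s \<circ> t"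
    using b by (metis o_assoc)
  have ss: "q \<circ> s \<circ> s = q" "q \<circ> t \<circ> t = q" for q :: "nat \<Rightarrow> nat"
    by (simp_all add: s_def t_def o_assoc[symmetric])
  have v: "s i = Suc i" "s (Suc i) = i" "s (Suc (Suc i)) = Suc (Suc i)"
     "t i = i" "t (Suc i) = Suc (Suc i)" "t (Suc (Suc i)) = Suc i"
    by (auto simp: s_def t_def transpose_def)
  show "hecke_op \<beta> i (hecke_op \<beta> (Suc i) (hecke_op \<beta> i C)) p =
   hecke_op \<beta> (Suc i) (hecke_op \<beta> i (hecke_op \<beta> (Suc i) C)) p"
    unfolding hecke_op_def s_def[symmetric] t_def[symmetric]
    by (auto simp: v b' ss algebra_simps)
qed

definition word_act :: "'a::comm_ring_1 \<Rightarrow> fword \<Rightarrow> ((nat \<Rightarrow> nat) \<Rightarrow> 'a) \<Rightarrow> (nat \<Rightarrow> nat) \<Rightarrow> 'a" where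
  "word_act \<beta> u = foldr (hecke_op \<beta>) (letters u)"

definition free_act ::
  "'a::comm_ring_1 \<Rightarrow> (fword \<Rightarrow>\<^sub>0 'a) \<Rightarrow> ((nat \<Rightarrow> nat) \<Rightarrow> 'a) \<Rightarrow> (nat \<Rightarrow> nat) \<Rightarrow> 'a" where
  "free_act \<beta> P C p = (\<Sum>u\<in>Poly_Mapping.keys P. Poly_Mapping.lookup P u * word_act \<beta> u C p)"

lemma word_act_add: "word_act \<beta> u (\<lambda>p. C p + D p) = (\<lambda>p. word_act \<beta> u C p + word_act \<beta> u D p)"
proof -
  have "foldr (hecke_op \<beta>) us (\<lambda>p. C p + D p)
      = (\<lambda>p. foldr (hecke_op \<beta>) us C p + foldr (hecke_op \<beta>) us D p)" for us
    by (induction us) (simp_all add: hecke_op_add)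
  then show ?thesis by (simp add: word_act_def)
qed

lemma word_act_cmult: "word_act \<beta> u (\<lambda>p. c * C p) = (\<lambda>p. c * word_act \<beta> u C p)"
proof -
  have "foldr (hecke_op \<beta>) us (\<lambda>p. c * C p) = (\<lambda>p. c * foldr (hecke_op \<beta>) us C p)" for us
    by (induction us) (simp_all add: hecke_op_cmult)
  then show ?thesis by (simp add: word_act_def)
qed

lemma word_act_plus: "word_act \<beta> (u + v) C = word_act \<beta> u (word_act \<beta> v C)"
  by (simp add: word_act_def plus_fword_def)

lemma free_act_zero [simp]: "free_act \<beta> 0 C = (\<lambda>p. 0)"
  by (rule ext) (simp add: free_act_def)

lemma free_act_single [simp]: "free_act \<beta> (Poly_Mapping.single u a) C = (\<lambda>p. a * word_act \<beta> u C p)"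
  by (rule ext) (cases "a = 0", simp_all add: free_act_def)

lemma free_act_plus: "free_act \<beta> (P + Q) C = (\<lambda>p. free_act \<beta> P C p + free_act \<beta> Q C p)"
proof (rule ext)
  fix p
  show "free_act \<beta> (P + Q) C p = free_act \<beta> P C p + free_act \<beta> Q C p"
    unfolding free_act_def
    by (rule setsum_keys_plus_distrib) (simp_all add: algebra_simps)
qed

lemma free_act_uminus: "free_act \<beta> (- P) C = (\<lambda>p. - free_act \<beta> P C p)"
proof -
  have "free_act \<beta> (P + - P) C = (\<lambda>p. 0)" by simp
  then show ?thesis unfolding free_act_plus
    by (simp add: fun_eq_iff eq_neg_iff_add_eq_0 add.commute)
qed

lemma free_act_minus: "free_act \<beta> (P - Q) C = (\<lambda>p. free_act \<beta> P C p - free_act \<beta> Q C p)"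
  using free_act_plus[of \<beta> P "- Q"] by (simp add: free_act_uminus)

text \<open>Induction over the monomials of a finitely supported function; it reduces statements that are additive
  in a noncommutative polynomial to statements about words.\<close>

lemma poly_mapping_single_induct [case_names zero single]:
  assumes "P 0" and "\<And>f u a. P f \<Longrightarrow> u \<notin> Poly_Mapping.keys f \<Longrightarrow> P (Poly_Mapping.single u a + f)"
  shows "P (f :: 'b \<Rightarrow>\<^sub>0 'c::comm_monoid_add)"
proof (induction f rule: update_induct)
  case const
  then show ?case by (rule assms(1))
next
  case (update f u a)
  have "Poly_Mapping.update u a f = Poly_Mapping.single u a + f"
    using update by (intro poly_mapping_eqI)
      (auto simp: lookup_update lookup_add lookup_single not_in_keys_iff_lookup_eq_zero)
  then show ?case using assms(2) update by simp
qed

lemma free_act_cmult_arg: "free_act \<beta> P (\<lambda>p. c * C p) = (\<lambda>p. c * free_act \<beta> P C p)"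
  by (rule ext) (simp add: free_act_def word_act_cmult sum_distrib_left algebra_simps)

lemma free_act_zero_arg: "free_act \<beta> P (\<lambda>p. 0) = (\<lambda>p. 0)"
  using free_act_cmult_arg[of \<beta> P 0 "\<lambda>p. 0"] by simp

lemma free_act_mult: "free_act \<beta> (P * Q) C = free_act \<beta> P (free_act \<beta> Q C)"
proof (induction P rule: poly_mapping_single_induct)
  case zero
  then show ?case by simp
next
  case (single P u a)
  have "free_act \<beta> (Poly_Mapping.single u a * Q) C = free_act \<beta> (Poly_Mapping.single u a) (free_act \<beta> Q C)"
  proof (induction Q rule: poly_mapping_single_induct)
    case zero
    then show ?case using free_act_zero_arg[of \<beta> "Poly_Mapping.single u a"] by simp
  next
    case (single Q v b)
    have "free_act \<beta> (Poly_Mapping.single u a * (Poly_Mapping.single v b + Q)) C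
      = (\<lambda>p. free_act \<beta> (Poly_Mapping.single (u + v) (a * b)) C p + free_act \<beta> (Poly_Mapping.single u a * Q) C p)"
      by (simp only: distrib_left free_act_plus mult_single)
    then show ?case using single
      by (simp add: free_act_plus word_act_add word_act_cmult word_act_plus algebra_simps)
  qed
  then show ?case using single
    by (simp only: distrib_right free_act_plus)
qed

lemma free_act_gen [simp]: "free_act \<beta> (gen i) C = hecke_op \<beta> i C"
  by (simp add: gen_def word_act_def)

lemma free_act_scalar [simp]: "free_act \<beta> (scalar c) C = (\<lambda>p. c * C p)"
  by (simp add: scalar_def word_act_def zero_fword_def)

lemma free_act_one [simp]: "free_act \<beta> 1 C = C"
  using free_act_scalar[of \<beta> 1 C] by (simp add: scalar_def)

lemma free_act_h_gen: "free_act \<beta> (h_gen i z) C = (\<lambda>p. C p + z * hecke_op \<beta> i C p)"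
  by (simp add: h_gen_def free_act_plus free_act_mult)

text \<open>The coefficient function of $e_{\mathrm{id}} = 1$.\<close>

definition delta_id :: "(nat \<Rightarrow> nat) \<Rightarrow> 'a::comm_ring_1" where
  "delta_id p = (if p = id then 1 else 0)"

section \<open>The defining ideal acts as zero\<close>

lemma ring_free_algebra: "ring (free_algebra N :: (fword \<Rightarrow>\<^sub>0 'a::comm_ring_1) ring)"
proof (rule ringI)
  let ?F = "free_algebra N :: (fword \<Rightarrow>\<^sub>0 'a) ring"
  show "abelian_group ?F"
  proof (rule abelian_groupI)
    fix x y assume "x \<in> carrier ?F" "y \<in> carrier ?F"
    then show "x \<oplus>\<^bsub>?F\<^esub> y \<in> carrier ?F"
      using keys_add[of x y] by (auto simp: free_algebra_def)
  next
    fix x assume x: "x \<in> carrier ?F"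
    have "Poly_Mapping.keys (- x) = Poly_Mapping.keys x"
      by (auto simp: in_keys_iff)
    with x have "- x \<in> carrier ?F" by (simp add: free_algebra_def)
    then show "\<exists>y\<in>carrier ?F. y \<oplus>\<^bsub>?F\<^esub> x = \<zero>\<^bsub>?F\<^esub>"
      by (intro bexI[of _ "- x"]) (simp_all add: free_algebra_def)
  qed (auto simp: free_algebra_def algebra_simps)
  show "Group.monoid ?F"
  proof (rule monoidI)
    fix x y assume xy: "x \<in> carrier ?F" "y \<in> carrier ?F"
    show "x \<otimes>\<^bsub>?F\<^esub> y \<in> carrier ?F"
    proof -
      have "set (letters u) \<subseteq> {1..<N}" if u: "u \<in> Poly_Mapping.keys (x * y)" for u
      proof -
        obtain a b where "a \<in> Poly_Mapping.keys x" "b \<in> Poly_Mapping.keys y" "u = a + b"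
          using keys_mult[of x y] u by blast
        with xy show ?thesis by (auto simp: free_algebra_def plus_fword_def)
      qed
      then show ?thesis by (simp add: free_algebra_def)
    qed
  qed (auto simp: free_algebra_def algebra_simps zero_fword_def)
qed (auto simp: free_algebra_def algebra_simps)

lemma carrier_free_algebra:
  "P \<in> carrier (free_algebra N) \<longleftrightarrow> (\<forall>u\<in>Poly_Mapping.keys P. set (letters u) \<subseteq> {1..<N})"
  by (simp add: free_algebra_def)

lemma free_algebra_simps [simp]:
  "x \<oplus>\<^bsub>free_algebra N\<^esub> y = x + y" "x \<otimes>\<^bsub>free_algebra N\<^esub> y = x * y"
  "\<zero>\<^bsub>free_algebra N\<^esub> = 0" "\<one>\<^bsub>free_algebra N\<^esub> = 1"
  by (simp_all add: free_algebra_def)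

lemma carrier_closed:
  assumes "x \<in> carrier (free_algebra N)" "y \<in> carrier (free_algebra N)"
  shows "x + y \<in> carrier (free_algebra N)" "x * y \<in> carrier (free_algebra N)"
  using ring.ring_simprules(1)[OF ring_free_algebra assms] ring.ring_simprules(5)[OF ring_free_algebra assms]
  by simp_all

lemma carrier_uminus: "x \<in> carrier (free_algebra N) \<Longrightarrow> - x \<in> carrier (free_algebra N)"
  by (auto simp: carrier_free_algebra in_keys_iff)

lemma free_algebra_uminus:
  assumes "x \<in> carrier (free_algebra N)"
  shows "\<ominus>\<^bsub>free_algebra N\<^esub> x = - x"
proof -
  interpret ring "free_algebra N :: (fword \<Rightarrow>\<^sub>0 'a::comm_ring_1) ring" by (rule ring_free_algebra)
  show ?thesis using assms carrier_uminus[OF assms] minus_equality[of "- x" x] by simp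
qed

lemma carrier_minus:
  assumes "x \<in> carrier (free_algebra N)" "y \<in> carrier (free_algebra N)"
  shows "x - y \<in> carrier (free_algebra N)"
  using carrier_closed(1)[OF assms(1) carrier_uminus[OF assms(2)]] by simp

lemma carrier_single: "set (letters u) \<subseteq> {1..<N} \<Longrightarrow> Poly_Mapping.single u a \<in> carrier (free_algebra N)"
  by (cases "a = 0") (simp_all add: carrier_free_algebra)

lemma carrier_simps [simp]:
  "scalar c \<in> carrier (free_algebra N)" "1 \<in> carrier (free_algebra N)" "0 \<in> carrier (free_algebra N)"
  "i \<in> {1..<N} \<Longrightarrow> gen i \<in> carrier (free_algebra N)"
  by (auto simp: scalar_def gen_def intro!: carrier_single)
     (simp_all add: carrier_free_algebra zero_fword_def)

lemma IdC_relators_carrier: "IdC_relators N \<beta> \<subseteq> carrier (free_algebra N)"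
  by (auto simp: IdC_relators_def intro!: carrier_minus carrier_closed)

lemma free_act_relator:
  assumes "r \<in> IdC_relators N \<beta>"
  shows "free_act \<beta> r C = (\<lambda>p. 0)"
proof -
  have comm: "hecke_op \<beta> i (hecke_op \<beta> j C) = hecke_op \<beta> j (hecke_op \<beta> i C)"
    if "\<bar>int i - int j\<bar> \<ge> 2" for i j
  proof -
    from that have "i + 2 \<le> j \<or> j + 2 \<le> i" by linarith
    then show ?thesis using hecke_op_commute[of i j \<beta> C] hecke_op_commute[of j i \<beta> C] by metis
  qed
  have braid: "hecke_op \<beta> i (hecke_op \<beta> j (hecke_op \<beta> i C)) = hecke_op \<beta> j (hecke_op \<beta> i (hecke_op \<beta> j C))"
    if "\<bar>int i - int j\<bar> = 1" for i j
  proof -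
    from that have "j = Suc i \<or> i = Suc j" by linarith
    then show ?thesis using hecke_op_braid[of \<beta> i C] hecke_op_braid[of \<beta> j C] by auto
  qed
  show ?thesis using assms comm braid
    by (auto simp: IdC_relators_def free_act_minus free_act_mult hecke_op_square)
qed

lemma ideal_IdC: "ideal (IdC_ideal N \<beta>) (free_algebra N)"
  unfolding IdC_ideal_def
  by (rule ring.genideal_ideal[OF ring_free_algebra IdC_relators_carrier])

text \<open>The elements acting as zero form a two-sided ideal, and it contains the defining relators. This gives
  the independence half of the basis theorem: the action is well defined on classes.\<close>

lemma free_act_ideal:
  assumes "P \<in> IdC_ideal N \<beta>"
  shows "free_act \<beta> P C = (\<lambda>p. 0)"
proof -
  let ?F = "free_algebra N :: (fword \<Rightarrow>\<^sub>0 'a) ring"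
  let ?K = "{P \<in> carrier ?F. \<forall>C. free_act \<beta> P C = (\<lambda>p. 0)}"
  interpret ring ?F by (rule ring_free_algebra)
  have "ideal ?K ?F"
  proof (rule idealI[OF ring_free_algebra])
    show "subgroup ?K (add_monoid ?F)"
    proof (rule subgroup.intro)
      fix x assume x: "x \<in> ?K"
      then have "inv\<^bsub>add_monoid ?F\<^esub> x = - x"
        using free_algebra_uminus[of x N] by (simp add: a_inv_def)
      with x show "inv\<^bsub>add_monoid ?F\<^esub> x \<in> ?K"
        by (simp add: carrier_uminus free_act_uminus)
    qed (auto simp: carrier_closed free_act_plus)
  qed (auto simp: carrier_closed free_act_mult free_act_zero_arg)
  moreover have "IdC_relators N \<beta> \<subseteq> ?K"
    using IdC_relators_carrier free_act_relator by blast
  ultimately have "IdC_ideal N \<beta> \<subseteq> ?K"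
    unfolding IdC_ideal_def by (rule genideal_minimal)
  with assms show ?thesis by blast
qed

section \<open>Inversions and reduced words\<close>

text \<open>The prefix \<open>inv\<close> also denotes the inverse in an abstract group, hence a name of its own for the
  inverse permutation.\<close>

abbreviation pinv :: "(nat \<Rightarrow> nat) \<Rightarrow> nat \<Rightarrow> nat" where
  "pinv \<equiv> inv_into UNIV"

definition inversion_number :: "(nat \<Rightarrow> nat) \<Rightarrow> nat" where
  "inversion_number w = card {(a, b). a < b \<and> w b < w a}"

lemma finite_inversions:
  fixes w :: "nat \<Rightarrow> nat"
  assumes "w permutes {1..N}"
  shows "finite {(a, b). a < b \<and> w b < w a}"
proof (rule finite_subset)
  have "a \<in> {1..N} \<and> b \<in> {1..N}" if "a < b" "w b < w a" for a b
  proof -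
    have "b \<le> N"
    proof (rule ccontr)
      assume "\<not> b \<le> N"
      then have "w b = b" using assms by (auto simp: permutes_def)
      with that have "a < w a" by linarith
      then have "a \<in> {1..N}" using assms by (metis less_irrefl permutes_def)
      then have "w a \<in> {1..N}" using assms by (simp only: permutes_in_image)
      with \<open>\<not> b \<le> N\<close> \<open>w b = b\<close> that show False by auto
    qed
    moreover have "1 \<le> a"
    proof (rule ccontr)
      assume "\<not> 1 \<le> a"
      then have "w a = a" using assms by (auto simp: permutes_def)
      with that \<open>\<not> 1 \<le> a\<close> show False by auto
    qed
    ultimately show ?thesis using that by auto
  qed
  then show "{(a, b). a < b \<and> w b < w a} \<subseteq> {1..N} \<times> {1..N}" by blast
qed simp

lemma simple_transposition_permutes:
  "i \<in> {1..<N} \<Longrightarrow> transpose i (Suc i) permutes {1..N}"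
  by (rule permutes_swap_id) auto

lemma simple_transposition_comp_permutes:
  "w permutes {1..N} \<Longrightarrow> i \<in> {1..<N} \<Longrightarrow> transpose i (Suc i) \<circ> w permutes {1..N}"
  by (rule permutes_compose[OF _ simple_transposition_permutes])

lemma inv_simple_transposition_comp:
  assumes "w permutes {1..N}"
  shows "pinv (transpose i (Suc i) \<circ> w) = pinv w \<circ> transpose i (Suc i)"
proof -
  have "pinv (transpose i (Suc i) \<circ> w) = pinv w \<circ> pinv (transpose i (Suc i))"
    by (rule o_inv_distrib) (simp_all add: permutes_bij[OF assms])
  then show ?thesis by simp
qed

lemma simple_transposition_cancel:
  "transpose i (Suc i) \<circ> (transpose i (Suc i) \<circ> w) = w"
  by (simp add: o_assoc)

text \<open>Left multiplication by $s_i$ exchanges the values $i$ and $i+1$. No other value lies between them, so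
  only the pair of positions holding these two values changes its status.\<close>

lemma inversion_number_ascent:
  assumes w: "w permutes {1..N}" and asc: "pinv w i < pinv w (Suc i)"
  shows "inversion_number (transpose i (Suc i) \<circ> w) = Suc (inversion_number w)"
proof -
  let ?s = "transpose i (Suc i)"
  let ?I = "{(a, b). a < b \<and> w b < w a}"
  let ?p = "(pinv w i, pinv w (Suc i))"
  have wi: "w x = y \<longleftrightarrow> x = pinv w y" for x y
    using permutes_inv_eq[OF w, of y x] by auto
  have s: "?s y < ?s x \<longleftrightarrow> (y < x \<and> \<not> (y = i \<and> x = Suc i)) \<or> (y = Suc i \<and> x = i)" for x y
    by (auto simp: transpose_def)
  have "{(a, b). a < b \<and> (?s \<circ> w) b < (?s \<circ> w) a} = insert ?p ?I"
    using asc by (auto simp: s wi)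
  moreover have "?p \<notin> ?I"
    using w by (auto simp: permutes_inverses(1))
  ultimately show ?thesis
    using finite_inversions[OF w] by (simp add: inversion_number_def)
qed

text \<open>This is the previous lemma for $s_i w$ in place of $w$.\<close>

lemma inversion_number_descent:
  assumes w: "w permutes {1..N}" and i: "i \<in> {1..<N}" and "pinv w (Suc i) < pinv w i"
  shows "Suc (inversion_number (transpose i (Suc i) \<circ> w)) = inversion_number w"
proof -
  have "pinv (transpose i (Suc i) \<circ> w) i < pinv (transpose i (Suc i) \<circ> w) (Suc i)"
    using assms by (simp add: inv_simple_transposition_comp[OF w])
  from inversion_number_ascent[OF simple_transposition_comp_permutes[OF w i] this]
  show ?thesis by (simp add: simple_transposition_cancel)
qed

lemma inv_permutes_cases:
  fixes w :: "nat \<Rightarrow> nat"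
  assumes w: "w permutes {1..N}"
  obtains "pinv w i < pinv w (Suc i)" | "pinv w (Suc i) < pinv w i"
proof -
  have "pinv w i \<noteq> pinv w (Suc i)"
    using permutes_inj[OF permutes_inv[OF w]] by (metis injD n_not_Suc_n)
  with that show thesis by linarith
qed

text \<open>An increasing \<open>v\<close> satisfies \<open>i \<le> v i\<close>, and a permutation of an initial segment that decreases no
  value is the identity.\<close>

lemma permutes_no_descent:
  assumes v: "v permutes {1..N}" and asc: "\<And>i. i \<in> {1..<N} \<Longrightarrow> v i < v (Suc i)"
  shows "v = (id :: nat \<Rightarrow> nat)"
proof -
  have "i \<le> v i" if "1 \<le> i" "i \<le> N" for i
    using that
  proof (induction i rule: nat_induct_at_least)
    case base
    then have "v 1 \<in> {1..N}" using v by (simp only: permutes_in_image) simp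
    then show ?case by simp
  next
    case (Suc i)
    then show ?case using asc[of i] by auto
  qed
  then show ?thesis by (intro permutes_natset_ge[OF v]) auto
qed

lemma word_perm_simps [simp]:
  "word_perm [] = id"
  "word_perm (i # is) = transpose i (Suc i) \<circ> word_perm is"
  by (simp_all add: word_perm_def)

lemma word_perm_permutes: "set is \<subseteq> {1..<N} \<Longrightarrow> word_perm is permutes {1..N}"
proof (induction "is")
  case Nil
  show ?case unfolding word_perm_simps by (rule permutes_id)
next
  case (Cons i "is")
  then show ?case
    using simple_transposition_comp_permutes[of "word_perm is" N i] by (simp del: o_apply)
qed

lemma inversion_number_id [simp]: "inversion_number id = 0"
proof -
  have "{(a, b). a < b \<and> id b < (id a :: nat)} = {}" by auto
  then show ?thesis by (simp only: inversion_number_def card.empty)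
qed

lemma inversion_number_word_perm:
  assumes "set is \<subseteq> {1..<N}"
  shows "inversion_number (word_perm is) \<le> length is"
  using assms
proof (induction "is")
  case (Cons i "is")
  then have w: "word_perm is permutes {1..N}" by (intro word_perm_permutes) simp
  show ?case
  proof (rule inv_permutes_cases[OF w, of i])
    assume "pinv (word_perm is) i < pinv (word_perm is) (Suc i)"
    from inversion_number_ascent[OF w this] show ?thesis using Cons by (simp del: o_apply)
  next
    assume "pinv (word_perm is) (Suc i) < pinv (word_perm is) i"
    from inversion_number_descent[OF w _ this] show ?thesis using Cons by (simp del: o_apply)
  qed
qed simp

lemma ex_word_of_inversion_length:
  assumes "w permutes {1..N}"
  shows "\<exists>is. set is \<subseteq> {1..<N} \<and> word_perm is = w \<and> length is = inversion_number w"
  using assms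
proof (induction "inversion_number w" arbitrary: w rule: less_induct)
  case less
  show ?case
  proof (cases "\<exists>i\<in>{1..<N}. pinv w (Suc i) < pinv w i")
    case True
    then obtain i where i: "i \<in> {1..<N}" "pinv w (Suc i) < pinv w i" by blast
    have inv: "Suc (inversion_number (transpose i (Suc i) \<circ> w)) = inversion_number w"
      by (rule inversion_number_descent[OF less.prems i])
    obtain js where js: "set js \<subseteq> {1..<N}" "word_perm js = transpose i (Suc i) \<circ> w"
      "length js = inversion_number (transpose i (Suc i) \<circ> w)"
      using less.hyps[OF _ simple_transposition_comp_permutes[OF less.prems i(1)]] inv by auto
    show ?thesis
      using i js inv by (intro exI[of _ "i # js"]) (simp add: simple_transposition_cancel)
  next
    case False
    have "pinv w = id"
    proof (rule permutes_no_descent[OF permutes_inv[OF less.prems]])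
      fix i assume "i \<in> {1..<N}"
      with False show "pinv w i < pinv w (Suc i)"
        using inv_permutes_cases[OF less.prems, of i] by blast
    qed
    then have "w = id"
      using permutes_inv_inv[OF less.prems] by simp
    then show ?thesis by (intro exI[of _ "[]"]) simp
  qed
qed

text \<open>Minimality of the length becomes a numerical condition: each letter changes the number of inversions by
  one, and multiplying by descents until none is left reaches that bound.\<close>

lemma reduced_word_iff:
  assumes w: "w permutes {1..N}"
  shows "reduced_word N w is \<longleftrightarrow>
    set is \<subseteq> {1..<N} \<and> word_perm is = w \<and> length is = inversion_number w"
  using ex_word_of_inversion_length[OF w] inversion_number_word_perm
  unfolding reduced_word_def by (metis le_antisym)

lemma reduced_word_permutes: "reduced_word N w is \<Longrightarrow> w permutes {1..N}"
  unfolding reduced_word_def using word_perm_permutes by blast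

lemma reduced_word_Cons:
  assumes w: "w permutes {1..N}" and i: "i \<in> {1..<N}" and "pinv w i < pinv w (Suc i)"
    and "reduced_word N w is"
  shows "reduced_word N (transpose i (Suc i) \<circ> w) (i # is)"
  using assms inversion_number_ascent[OF w assms(3)]
  unfolding reduced_word_iff[OF w] reduced_word_iff[OF simple_transposition_comp_permutes[OF w i]]
  by (simp del: o_apply)

lemma reduced_word_ConsD:
  assumes red: "reduced_word N w (i # is)"
  shows "i \<in> {1..<N}" "pinv w (Suc i) < pinv w i" "reduced_word N (transpose i (Suc i) \<circ> w) is"
proof -
  have w: "w permutes {1..N}" by (rule reduced_word_permutes[OF red])
  have r: "set (i # is) \<subseteq> {1..<N}" "word_perm (i # is) = w" "length (i # is) = inversion_number w"
    using red reduced_word_iff[OF w] by blast+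
  show i: "i \<in> {1..<N}" using r by simp
  have v: "transpose i (Suc i) \<circ> w = word_perm is"
    using r(2) simple_transposition_cancel[of i "word_perm is"] by simp
  have le: "inversion_number (transpose i (Suc i) \<circ> w) \<le> length is"
    unfolding v using r(1) inversion_number_word_perm[of "is" N] by simp
  show desc: "pinv w (Suc i) < pinv w i"
  proof (rule inv_permutes_cases[OF w, of i])
    assume "pinv w i < pinv w (Suc i)"
    from inversion_number_ascent[OF w this] le r(3) show ?thesis by simp
  qed
  show "reduced_word N (transpose i (Suc i) \<circ> w) is"
    using r v inversion_number_descent[OF w i desc]
    unfolding reduced_word_iff[OF simple_transposition_comp_permutes[OF w i]] by simp
qed

lemma ex_reduced_word: "w permutes {1..N} \<Longrightarrow> \<exists>is. reduced_word N w is"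
  using ex_word_of_inversion_length[of w N] reduced_word_iff[of w N] by blast

section \<open>The basis theorem\<close>

text \<open>Equality in the quotient algebra, as a congruence between representatives.\<close>

definition IdC_eq :: "nat \<Rightarrow> 'a::comm_ring_1 \<Rightarrow> (fword \<Rightarrow>\<^sub>0 'a) \<Rightarrow> (fword \<Rightarrow>\<^sub>0 'a) \<Rightarrow> bool" where
  "IdC_eq N \<beta> P Q \<longleftrightarrow> P - Q \<in> IdC_ideal N \<beta>"

context
  fixes N :: nat and \<beta> :: "'a::comm_ring_1"
begin

private lemma zero_ideal: "0 \<in> IdC_ideal N \<beta>"
  and add_ideal: "P \<in> IdC_ideal N \<beta> \<Longrightarrow> Q \<in> IdC_ideal N \<beta> \<Longrightarrow> P + Q \<in> IdC_ideal N \<beta>"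
  and uminus_ideal: "P \<in> IdC_ideal N \<beta> \<Longrightarrow> - P \<in> IdC_ideal N \<beta>"
  and mult_left_ideal: "R \<in> carrier (free_algebra N) \<Longrightarrow> P \<in> IdC_ideal N \<beta> \<Longrightarrow> R * P \<in> IdC_ideal N \<beta>"
  and mult_right_ideal: "R \<in> carrier (free_algebra N) \<Longrightarrow> P \<in> IdC_ideal N \<beta> \<Longrightarrow> P * R \<in> IdC_ideal N \<beta>"
proof -
  interpret I: ideal "IdC_ideal N \<beta>" "free_algebra N" by (rule ideal_IdC)
  note sub = ideal.axioms(1)[OF ideal_IdC[of N \<beta>]]
  show "0 \<in> IdC_ideal N \<beta>" using additive_subgroup.zero_closed[OF sub] by simp
  show "P + Q \<in> IdC_ideal N \<beta>" if "P \<in> IdC_ideal N \<beta>" "Q \<in> IdC_ideal N \<beta>"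
    using additive_subgroup.a_closed[OF sub that] by simp
  show left: "R * P \<in> IdC_ideal N \<beta>" if "R \<in> carrier (free_algebra N)" "P \<in> IdC_ideal N \<beta>" for R P
    using I.I_l_closed[OF that(2,1)] by simp
  show "- P \<in> IdC_ideal N \<beta>" if P: "P \<in> IdC_ideal N \<beta>"
    using left[OF carrier_uminus[of 1] P] by simp
  show "P * R \<in> IdC_ideal N \<beta>" if "R \<in> carrier (free_algebra N)" "P \<in> IdC_ideal N \<beta>"
    using I.I_r_closed[OF that(2,1)] by simp
qed

lemma IdC_eq_refl [simp]: "IdC_eq N \<beta> P P"
  by (simp add: IdC_eq_def zero_ideal)

lemma IdC_eq_sym: "IdC_eq N \<beta> P Q \<Longrightarrow> IdC_eq N \<beta> Q P"
  using uminus_ideal[of "P - Q"] by (simp add: IdC_eq_def)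

lemma IdC_eq_trans [trans]: "IdC_eq N \<beta> P Q \<Longrightarrow> IdC_eq N \<beta> Q R \<Longrightarrow> IdC_eq N \<beta> P R"
  using add_ideal[of "P - Q" "Q - R"] by (simp add: IdC_eq_def)

lemma IdC_eq_add: "IdC_eq N \<beta> P Q \<Longrightarrow> IdC_eq N \<beta> P' Q' \<Longrightarrow> IdC_eq N \<beta> (P + P') (Q + Q')"
  using add_ideal[of "P - Q" "P' - Q'"] by (simp add: IdC_eq_def algebra_simps)

lemma IdC_eq_mult_left:
  "R \<in> carrier (free_algebra N) \<Longrightarrow> IdC_eq N \<beta> P Q \<Longrightarrow> IdC_eq N \<beta> (R * P) (R * Q)"
  using mult_left_ideal[of R "P - Q"] by (simp add: IdC_eq_def algebra_simps)

lemma IdC_eq_mult_right: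
  "R \<in> carrier (free_algebra N) \<Longrightarrow> IdC_eq N \<beta> P Q \<Longrightarrow> IdC_eq N \<beta> (P * R) (Q * R)"
  using mult_right_ideal[of R "P - Q"] by (simp add: IdC_eq_def algebra_simps)

lemma IdC_eq_relator:
  assumes "P - Q \<in> IdC_relators N \<beta>"
  shows "IdC_eq N \<beta> P Q"
  using assms ring.genideal_self[OF ring_free_algebra IdC_relators_carrier, of N \<beta>]
  by (auto simp: IdC_eq_def IdC_ideal_def)

lemma IdC_eq_commute:
  "i \<in> {1..<N} \<Longrightarrow> j \<in> {1..<N} \<Longrightarrow> \<bar>int i - int j\<bar> \<ge> 2 \<Longrightarrow> IdC_eq N \<beta> (gen i * gen j) (gen j * gen i)"
  by (rule IdC_eq_relator) (auto simp: IdC_relators_def)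

lemma IdC_eq_braid:
  "i \<in> {1..<N} \<Longrightarrow> j \<in> {1..<N} \<Longrightarrow> \<bar>int i - int j\<bar> = 1 \<Longrightarrow>
   IdC_eq N \<beta> (gen i * gen j * gen i) (gen j * gen i * gen j)"
  by (rule IdC_eq_relator) (auto simp: IdC_relators_def)

lemma IdC_eq_square:
  "i \<in> {1..<N} \<Longrightarrow> IdC_eq N \<beta> (gen i * gen i) (scalar \<beta> * gen i)"
  by (rule IdC_eq_relator) (auto simp: IdC_relators_def)

lemma IdC_class_eq_iff:
  assumes "P \<in> carrier (free_algebra N)" "Q \<in> carrier (free_algebra N)"
  shows "IdC_class N \<beta> P = IdC_class N \<beta> Q \<longleftrightarrow> IdC_eq N \<beta> P Q"
proof -
  interpret ring "free_algebra N :: (fword \<Rightarrow>\<^sub>0 'a) ring" by (rule ring_free_algebra)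
  show ?thesis
    unfolding IdC_class_def IdC_eq_def
    using quotient_eq_iff_same_a_r_cos[OF ideal_IdC assms] assms
    by (simp add: a_minus_def free_algebra_uminus)
qed

lemma carrier_gen_word:
  "set is \<subseteq> {1..<N} \<Longrightarrow> prod_list (map gen is) \<in> carrier (free_algebra N)"
  by (induction "is") (auto intro!: carrier_closed)

text \<open>Matsumoto's theorem in the form needed here: two reduced words of $w$ give the same element of the
  algebra. Let the words begin with $i$ and $j$, so that both are left descents of $w$. If $i = j$, cancel
  the letter. Otherwise $w$ has a reduced word beginning with $ij$ or with $iji$, according to whether the
  two reflections commute, and, by the defining relation, another one beginning with $ji$ or $jij$; each of
  these agrees with one of the given words by induction, since it shares the first letter with it.\<close>

lemma gen_word_eq_of_reduced:
  assumes "reduced_word N w is" "reduced_word N w js"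
  shows "IdC_eq N \<beta> (prod_list (map gen is)) (prod_list (map gen js))"
  using assms
proof (induction "length is" arbitrary: w "is" js rule: less_induct)
  case less
  have w: "w permutes {1..N}" by (rule reduced_word_permutes[OF less.prems(1)])
  note red = less.prems[unfolded reduced_word_iff[OF w]]
  show ?case
  proof (cases "is")
    case Nil
    with red have "js = []" by simp
    with Nil show ?thesis by simp
  next
    case (Cons i is')
    with red obtain j js' where js: "js = j # js'" by (cases js) auto
    note ri = reduced_word_ConsD[OF less.prems(1)[unfolded Cons]]
    note rj = reduced_word_ConsD[OF less.prems(2)[unfolded js]]
    let ?s = "\<lambda>i. transpose i (Suc i)"
    note wi = simple_transposition_comp_permutes[OF w ri(1)]
    note wj = simple_transposition_comp_permutes[OF w rj(1)]
    have len: "length is' < length is" "length js' < length is"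
      using Cons js red by auto
    note [simp] = carrier_closed carrier_simps(4)[OF ri(1)] carrier_simps(4)[OF rj(1)] carrier_gen_word
    have goal_of: ?thesis
      if P: "P \<in> carrier (free_algebra N)"
        and 1: "IdC_eq N \<beta> (prod_list (map gen is')) P"
        and Q: "Q \<in> carrier (free_algebra N)"
        and 2: "IdC_eq N \<beta> (prod_list (map gen js')) Q"
        and 3: "IdC_eq N \<beta> (gen i * P) (gen j * Q)" for P Q
    proof -
      have "IdC_eq N \<beta> (prod_list (map gen is)) (gen i * P)"
        using IdC_eq_mult_left[OF carrier_simps(4)[OF ri(1)] 1] by (simp add: Cons)
      also note 3
      also have "IdC_eq N \<beta> (gen j * Q) (prod_list (map gen js))"
        using IdC_eq_sym[OF IdC_eq_mult_left[OF carrier_simps(4)[OF rj(1)] 2]] by (simp add: js)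
      finally show ?thesis .
    qed
    consider (same) "i = j" | (far) "\<bar>int i - int j\<bar> \<ge> 2" | (near) "\<bar>int i - int j\<bar> = 1"
      by linarith
    then show ?thesis
    proof cases
      case same
      then have "IdC_eq N \<beta> (prod_list (map gen is')) (prod_list (map gen js'))"
        using less.hyps[OF len(1) ri(3)] rj(3) by simp
      from IdC_eq_mult_left[OF carrier_simps(4)[OF ri(1)] this] show ?thesis
        by (simp add: Cons js same)
    next
      case far
      \<comment> \<open>$v$ is what remains of $w$ after removing the two commuting letters\<close>
      define v where "v = ?s j \<circ> (?s i \<circ> w)"
      have v': "v = ?s i \<circ> (?s j \<circ> w)"
        unfolding v_def using far transpose_commute_far[of i j] transpose_commute_far[of j i]
        by (cases "i \<le> j") (simp_all add: o_assoc)
      have v: "v permutes {1..N}"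
        unfolding v_def by (rule simple_transposition_comp_permutes[OF wi rj(1)])
      obtain ks where ks: "reduced_word N v ks" using ex_reduced_word[OF v] by blast
      have c: "prod_list (map gen ks) \<in> carrier (free_algebra N)"
        using ks by (intro carrier_gen_word) (simp add: reduced_word_def)
      have jv: "?s j \<circ> v = ?s i \<circ> w" and iv: "?s i \<circ> v = ?s j \<circ> w"
        by (simp_all only: v_def v' simple_transposition_cancel)
           (simp only: v_def[symmetric] v' simple_transposition_cancel)
      have asc: "pinv v j < pinv v (Suc j)" "pinv v i < pinv v (Suc i)"
      proof -
        have "pinv v = pinv w \<circ> ?s i \<circ> ?s j" unfolding v_def
          by (simp add: inv_simple_transposition_comp[OF wi] inv_simple_transposition_comp[OF w])
        then show "pinv v j < pinv v (Suc j)" "pinv v i < pinv v (Suc i)"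
          using far ri(2) rj(2) by (auto simp: transpose_def)
      qed
      have "reduced_word N (?s i \<circ> w) (j # ks)" "reduced_word N (?s j \<circ> w) (i # ks)"
        using reduced_word_Cons[OF v rj(1) asc(1) ks] reduced_word_Cons[OF v ri(1) asc(2) ks]
        unfolding jv iv .
      then have 1: "IdC_eq N \<beta> (prod_list (map gen is')) (gen j * prod_list (map gen ks))"
        and 2: "IdC_eq N \<beta> (prod_list (map gen js')) (gen i * prod_list (map gen ks))"
        using less.hyps[OF len(1) ri(3)] less.hyps[OF len(2) rj(3)] by fastforce+
      have 3: "IdC_eq N \<beta> (gen i * (gen j * prod_list (map gen ks))) (gen j * (gen i * prod_list (map gen ks)))"
        using IdC_eq_mult_right[OF c IdC_eq_commute[OF ri(1) rj(1) far]] by (simp add: mult.assoc)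
      show ?thesis by (rule goal_of[OF _ 1 _ 2 3]) (simp_all add: c)
    next
      case near
      \<comment> \<open>$v$ is what remains of $w$ after removing the longest element of the subgroup generated by $s_i$ and $s_j$\<close>
      define v where "v = ?s i \<circ> (?s j \<circ> (?s i \<circ> w))"
      have v': "v = ?s j \<circ> (?s i \<circ> (?s j \<circ> w))"
      proof -
        from near have "j = Suc i \<or> i = Suc j" by linarith
        then show ?thesis using transpose_braid[of i] transpose_braid[of j]
          by (auto simp: v_def o_assoc)
      qed
      note wji = simple_transposition_comp_permutes[OF wi rj(1)]
      note wij = simple_transposition_comp_permutes[OF wj ri(1)]
      have v: "v permutes {1..N}"
        unfolding v_def by (rule simple_transposition_comp_permutes[OF wji ri(1)])
      obtain ks where ks: "reduced_word N v ks" using ex_reduced_word[OF v] by blast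
      have c: "prod_list (map gen ks) \<in> carrier (free_algebra N)"
        using ks by (intro carrier_gen_word) (simp add: reduced_word_def)
      have iv: "?s i \<circ> v = ?s j \<circ> (?s i \<circ> w)" and jv: "?s j \<circ> v = ?s i \<circ> (?s j \<circ> w)"
        by (simp only: v_def simple_transposition_cancel)
           (simp only: v' simple_transposition_cancel)
      have jiv: "?s j \<circ> (?s i \<circ> v) = ?s i \<circ> w" and ijv: "?s i \<circ> (?s j \<circ> v) = ?s j \<circ> w"
        by (simp_all only: iv jv simple_transposition_cancel)
      note inv_comp = inv_simple_transposition_comp[OF w] inv_simple_transposition_comp[OF wi]
        inv_simple_transposition_comp[OF wj] inv_simple_transposition_comp[OF wji]
        inv_simple_transposition_comp[OF wij]
      have inv: "pinv v = pinv w \<circ> ?s i \<circ> ?s j \<circ> ?s i"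
        "pinv (?s i \<circ> v) = pinv w \<circ> ?s i \<circ> ?s j" "pinv (?s j \<circ> v) = pinv w \<circ> ?s j \<circ> ?s i"
        unfolding iv jv by (simp_all only: v_def inv_comp)
      have inv': "pinv v = pinv w \<circ> ?s j \<circ> ?s i \<circ> ?s j"
        by (simp only: v' inv_comp)
      have asc: "pinv v i < pinv v (Suc i)" "pinv v j < pinv v (Suc j)"
        "pinv (?s i \<circ> v) j < pinv (?s i \<circ> v) (Suc j)" "pinv (?s j \<circ> v) i < pinv (?s j \<circ> v) (Suc i)"
      proof -
        from near have "j = Suc i \<or> i = Suc j" by linarith
        then show "pinv v i < pinv v (Suc i)" "pinv v j < pinv v (Suc j)"
          "pinv (?s i \<circ> v) j < pinv (?s i \<circ> v) (Suc j)" "pinv (?s j \<circ> v) i < pinv (?s j \<circ> v) (Suc i)"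
          unfolding inv(1-3) using ri(2) rj(2) by (auto simp: transpose_def)
      qed
      note vi = simple_transposition_comp_permutes[OF v ri(1)]
      note vj = simple_transposition_comp_permutes[OF v rj(1)]
      have "reduced_word N (?s i \<circ> w) (j # i # ks)" "reduced_word N (?s j \<circ> w) (i # j # ks)"
        using reduced_word_Cons[OF vi rj(1) asc(3) reduced_word_Cons[OF v ri(1) asc(1) ks]]
          reduced_word_Cons[OF vj ri(1) asc(4) reduced_word_Cons[OF v rj(1) asc(2) ks]]
        unfolding jiv ijv .
      then have 1: "IdC_eq N \<beta> (prod_list (map gen is')) (gen j * (gen i * prod_list (map gen ks)))"
        and 2: "IdC_eq N \<beta> (prod_list (map gen js')) (gen i * (gen j * prod_list (map gen ks)))"
        using less.hyps[OF len(1) ri(3)] less.hyps[OF len(2) rj(3)] by fastforce+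
      have 3: "IdC_eq N \<beta> (gen i * (gen j * (gen i * prod_list (map gen ks))))
          (gen j * (gen i * (gen j * prod_list (map gen ks))))"
        using IdC_eq_mult_right[OF c IdC_eq_braid[OF ri(1) rj(1) near]] by (simp add: mult.assoc)
      show ?thesis by (rule goal_of[OF _ 1 _ 2 3]) (simp_all add: c)
    qed
  qed
qed

lemma e_perm_reduced:
  assumes "w permutes {1..N}"
  obtains "is" where "reduced_word N w is" "e_perm N w = (prod_list (map gen is) :: fword \<Rightarrow>\<^sub>0 'a)"
  using someI_ex[OF ex_reduced_word[OF assms]] by (auto simp: e_perm_def)

lemma carrier_e_perm:
  assumes "w permutes {1..N}"
  shows "(e_perm N w :: fword \<Rightarrow>\<^sub>0 'a) \<in> carrier (free_algebra N)"
  by (rule e_perm_reduced[OF assms]) (simp add: reduced_word_def carrier_gen_word)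

lemma gen_mult_e_perm_ascent:
  assumes w: "w permutes {1..N}" and i: "i \<in> {1..<N}" and asc: "pinv w i < pinv w (Suc i)"
  shows "IdC_eq N \<beta> (gen i * e_perm N w) (e_perm N (transpose i (Suc i) \<circ> w))"
proof -
  obtain "is" where 1: "reduced_word N w is" "e_perm N w = (prod_list (map gen is) :: fword \<Rightarrow>\<^sub>0 'a)"
    by (rule e_perm_reduced[OF w])
  obtain js where 2: "reduced_word N (transpose i (Suc i) \<circ> w) js"
    "e_perm N (transpose i (Suc i) \<circ> w) = (prod_list (map gen js) :: fword \<Rightarrow>\<^sub>0 'a)"
    by (rule e_perm_reduced[OF simple_transposition_comp_permutes[OF w i]])
  show ?thesis
    using gen_word_eq_of_reduced[OF reduced_word_Cons[OF w i asc 1(1)] 2(1)] by (simp add: 1 2)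
qed

lemma gen_mult_e_perm_descent:
  assumes w: "w permutes {1..N}" and i: "i \<in> {1..<N}" and desc: "pinv w (Suc i) < pinv w i"
  shows "IdC_eq N \<beta> (gen i * e_perm N w) (scalar \<beta> * e_perm N w)"
proof -
  let ?v = "transpose i (Suc i) \<circ> w"
  note v = simple_transposition_comp_permutes[OF w i]
  have "pinv ?v i < pinv ?v (Suc i)"
    using desc by (simp add: inv_simple_transposition_comp[OF w])
  from gen_mult_e_perm_ascent[OF v i this]
  have 1: "IdC_eq N \<beta> (gen i * e_perm N ?v) (e_perm N w)"
    by (simp add: simple_transposition_cancel)
  note [simp] = carrier_closed carrier_simps(4)[OF i] carrier_e_perm[OF v]
  have "IdC_eq N \<beta> (gen i * e_perm N w) (gen i * (gen i * e_perm N ?v))"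
    by (rule IdC_eq_mult_left[OF _ IdC_eq_sym[OF 1]]) simp
  also have "IdC_eq N \<beta> (gen i * (gen i * e_perm N ?v)) (scalar \<beta> * (gen i * e_perm N ?v))"
    using IdC_eq_mult_right[OF carrier_e_perm[OF v] IdC_eq_square[OF i]] by (simp add: mult.assoc)
  also have "IdC_eq N \<beta> (scalar \<beta> * (gen i * e_perm N ?v)) (scalar \<beta> * e_perm N w)"
    by (rule IdC_eq_mult_left[OF _ 1]) simp
  finally show ?thesis .
qed

lemma scalar_mult: "scalar (a * b) = scalar a * (scalar b :: fword \<Rightarrow>\<^sub>0 'a)"
  by (simp add: scalar_def mult_single)

lemma scalar_add: "scalar (a + b) = scalar a + (scalar b :: fword \<Rightarrow>\<^sub>0 'a)"
  by (simp add: scalar_def single_add)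

lemma gen_scalar_commute: "gen i * scalar a = scalar a * (gen i :: fword \<Rightarrow>\<^sub>0 'a)"
  by (simp add: scalar_def gen_def mult_single)

text \<open>A word never splits into a sum: each additional letter either lengthens the permutation or
  contributes a factor $\beta$.\<close>

lemma gen_word_eq_multiple_e_perm:
  assumes "set is \<subseteq> {1..<N}"
  shows "\<exists>w a. w permutes {1..N} \<and> IdC_eq N \<beta> (prod_list (map gen is)) (scalar a * e_perm N w)"
  using assms
proof (induction "is")
  case Nil
  have p: "id permutes {1..N}" by (rule permutes_id)
  obtain "is" where "reduced_word N id is" "e_perm N id = (prod_list (map gen is) :: fword \<Rightarrow>\<^sub>0 'a)"
    by (rule e_perm_reduced[OF p])
  then have "e_perm N id = (1 :: fword \<Rightarrow>\<^sub>0 'a)" by (simp add: reduced_word_iff[OF p])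
  with p show ?case
    by (intro exI[of _ id] exI[of _ 1]) (simp add: scalar_def del: id_apply)
next
  case (Cons i "is")
  then obtain w a where w: "w permutes {1..N}"
    and e: "IdC_eq N \<beta> (prod_list (map gen is)) (scalar a * e_perm N w)" by auto
  from Cons have i: "i \<in> {1..<N}" by simp
  have "IdC_eq N \<beta> (prod_list (map gen (i # is))) (gen i * (scalar a * e_perm N w))"
    using IdC_eq_mult_left[OF carrier_simps(4)[OF i] e] by simp
  also have "gen i * (scalar a * e_perm N w) = scalar a * (gen i * e_perm N w)"
    by (simp only: mult.assoc[symmetric] gen_scalar_commute)
  finally have 1: "IdC_eq N \<beta> (prod_list (map gen (i # is))) (scalar a * (gen i * e_perm N w))" .
  show ?case
  proof (rule inv_permutes_cases[OF w, of i])
    assume "pinv w i < pinv w (Suc i)"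
    from IdC_eq_trans[OF 1 IdC_eq_mult_left[OF _ gen_mult_e_perm_ascent[OF w i this]]]
    show ?thesis using simple_transposition_comp_permutes[OF w i] by auto
  next
    assume "pinv w (Suc i) < pinv w i"
    from IdC_eq_trans[OF 1 IdC_eq_mult_left[OF _ gen_mult_e_perm_descent[OF w i this]]]
    have "IdC_eq N \<beta> (prod_list (map gen (i # is))) (scalar (a * \<beta>) * e_perm N w)"
      by (simp add: scalar_mult mult.assoc)
    with w show ?thesis by blast
  qed
qed

lemma single_eq_gen_word: "Poly_Mapping.single (FWord is) a = scalar a * (prod_list (map gen is) :: fword \<Rightarrow>\<^sub>0 'a)"
proof -
  have "prod_list (map gen is) = (Poly_Mapping.single (FWord is) 1 :: fword \<Rightarrow>\<^sub>0 'a)"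
    by (induction "is") (simp_all add: gen_def mult_single plus_fword_def flip: zero_fword_def)
  then show ?thesis by (simp add: scalar_def mult_single)
qed

lemma IdC_spanned_by_e_perm:
  assumes "P \<in> carrier (free_algebra N)"
  shows "\<exists>c. (\<forall>w. \<not> w permutes {1..N} \<longrightarrow> c w = 0) \<and>
    IdC_eq N \<beta> P (\<Sum>w | w permutes {1..N}. scalar (c w) * e_perm N w)"
  using assms
proof (induction P rule: poly_mapping_single_induct)
  case zero
  show ?case by (intro exI[of _ "\<lambda>_. 0"]) (simp add: scalar_def)
next
  case (single f u a)
  have fin: "finite {w. w permutes {1..N}}" by (rule finite_permutations) simp
  have keys: "Poly_Mapping.keys f \<subseteq> Poly_Mapping.keys (Poly_Mapping.single u a + f)"
  proof
    fix v assume "v \<in> Poly_Mapping.keys f"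
    with single.hyps show "v \<in> Poly_Mapping.keys (Poly_Mapping.single u a + f)"
      by (cases "v = u") (auto simp: in_keys_iff lookup_add lookup_single)
  qed
  with single.prems have "f \<in> carrier (free_algebra N)" by (auto simp: carrier_free_algebra)
  then obtain c where c: "\<forall>w. \<not> w permutes {1..N} \<longrightarrow> c w = 0"
    "IdC_eq N \<beta> f (\<Sum>w | w permutes {1..N}. scalar (c w) * e_perm N w)"
    using single.IH by blast
  show ?case
  proof (cases "a = 0")
    case True
    with c show ?thesis by auto
  next
    case False
    with single.hyps have "u \<in> Poly_Mapping.keys (Poly_Mapping.single u a + f)"
      by (auto simp: in_keys_iff lookup_add)
    with single.prems have "set (letters u) \<subseteq> {1..<N}" by (auto simp: carrier_free_algebra)
    then obtain w b where w: "w permutes {1..N}"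
      and e: "IdC_eq N \<beta> (prod_list (map gen (letters u))) (scalar b * e_perm N w)"
      using gen_word_eq_multiple_e_perm by blast
    have "IdC_eq N \<beta> (Poly_Mapping.single u a) (scalar (a * b) * e_perm N w)"
      using IdC_eq_mult_left[OF carrier_simps(1) e, of a] single_eq_gen_word[of "letters u" a]
      by (simp add: scalar_mult mult.assoc)
    from IdC_eq_add[OF this c(2)]
    have "IdC_eq N \<beta> (Poly_Mapping.single u a + f)
      (scalar (a * b) * e_perm N w + (\<Sum>w | w permutes {1..N}. scalar (c w) * e_perm N w))" .
    also have "scalar (a * b) * e_perm N w + (\<Sum>w | w permutes {1..N}. scalar (c w) * e_perm N w)
      = (\<Sum>v | v permutes {1..N}. scalar ((c(w := c w + a * b)) v) * e_perm N v)"
      using w fin by (simp add: sum.remove[of _ w] scalar_add algebra_simps)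
    finally show ?thesis
      using c(1) w by (intro exI[of _ "c(w := c w + a * b)"]) auto
  qed
qed

lemma free_act_sum: "free_act \<beta> (\<Sum>i\<in>I. P i) C p = (\<Sum>i\<in>I. free_act \<beta> (P i) C p)"
  by (induction I rule: infinite_finite_induct) (simp_all add: free_act_plus)

text \<open>Applying the letters of a reduced word to the function of $1$ moves the support from the identity to
  \<open>w\<close>; at each stage the term with $\beta$ vanishes because the previous permutation is shorter.\<close>

lemma free_act_reduced_word:
  assumes "reduced_word N w is" "v permutes {1..N}"
  shows "free_act \<beta> (prod_list (map gen is)) delta_id (pinv v) = (if v = w then 1 else 0)"
  using assms
proof (induction "is" arbitrary: v w)
  case Nil
  then have w: "w = id" using reduced_word_permutes[OF Nil(1)] by (simp add: reduced_word_def)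
  have "pinv v = id \<longleftrightarrow> v = id" using permutes_inv_inv[OF Nil(2)] by (metis inv_id)
  then show ?case by (simp add: delta_id_def w del: id_apply)
next
  case (Cons i "is")
  let ?s = "transpose i (Suc i)"
  note r = reduced_word_ConsD[OF Cons.prems(1)]
  note w = reduced_word_permutes[OF Cons.prems(1)]
  note sv = simple_transposition_comp_permutes[OF Cons.prems(2) r(1)]
  have 1: "free_act \<beta> (prod_list (map gen is)) delta_id (pinv v) = (if v = ?s \<circ> w then 1 else 0)"
    by (rule Cons.IH[OF r(3) Cons.prems(2)])
  have 2: "free_act \<beta> (prod_list (map gen is)) delta_id (pinv v \<circ> ?s) = (if ?s \<circ> v = ?s \<circ> w then 1 else 0)"
    using Cons.IH[OF r(3) sv] by (simp add: inv_simple_transposition_comp[OF Cons.prems(2)] del: o_apply)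
  have inj: "?s \<circ> v = ?s \<circ> w \<longleftrightarrow> v = w"
    by (metis simple_transposition_cancel)
  have "\<not> pinv v (Suc i) < pinv v i" if "v = ?s \<circ> w"
    using r(2) by (simp add: that inv_simple_transposition_comp[OF w])
  moreover have "free_act \<beta> (prod_list (map gen (i # is))) delta_id (pinv v) =
      (if pinv v (Suc i) < pinv v i then (if v = w then 1 else 0) + \<beta> * (if v = ?s \<circ> w then 1 else 0) else 0)"
    by (simp add: free_act_mult hecke_op_def 1 2 inj del: o_apply)
  ultimately show ?case using r(2) by auto
qed

lemma free_act_e_perm:
  assumes "w permutes {1..N}" "v permutes {1..N}"
  shows "free_act \<beta> (e_perm N w) delta_id (pinv v) = (if v = w then 1 else 0)"
  by (rule e_perm_reduced[OF assms(1)]) (simp add: free_act_reduced_word[OF _ assms(2)])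

text \<open>The coordinates are those of a basis: the $e_w$ span by the normal form of words, and the action
  recovers the coefficients of any linear combination of them.\<close>

theorem IdC_coords_eq:
  assumes P: "P \<in> carrier (free_algebra N)" and v: "v permutes {1..N}"
  shows "IdC_coords N \<beta> P v = free_act \<beta> P delta_id (pinv v)"
proof -
  have fin: "finite {w. w permutes {1..N}}" by (rule finite_permutations) simp
  have carr: "(\<Sum>w | w permutes {1..N}. scalar (c w) * e_perm N w) \<in> carrier (free_algebra N)"
    for c :: "_ \<Rightarrow> 'a"
  proof -
    have "(\<Sum>w\<in>S. scalar (c w) * e_perm N w) \<in> carrier (free_algebra N)"
      if "finite S" "S \<subseteq> {w. w permutes {1..N}}" for S
      using that by (induction S rule: finite_induct) (auto intro!: carrier_closed carrier_e_perm)
    with fin show ?thesis by blast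
  qed
  have val: "c u = free_act \<beta> P delta_id (pinv u)"
    if eq: "IdC_eq N \<beta> P (\<Sum>w | w permutes {1..N}. scalar (c w) * e_perm N w)"
      and u: "u permutes {1..N}" for c u
  proof -
    have "free_act \<beta> P delta_id (pinv u)
      = free_act \<beta> (\<Sum>w | w permutes {1..N}. scalar (c w) * e_perm N w) delta_id (pinv u)"
      using free_act_ideal[OF eq[unfolded IdC_eq_def], of delta_id]
      by (simp add: free_act_minus fun_eq_iff)
    also have "\<dots> = (\<Sum>w | w permutes {1..N}. c w * (if u = w then 1 else 0))"
      unfolding free_act_sum
      by (rule sum.cong) (auto simp: free_act_mult free_act_e_perm[OF _ u])
    also have "\<dots> = c u"
      using u fin by (simp add: sum.delta if_distrib cong: if_cong)
    finally show ?thesis by simp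
  qed
  obtain c where c: "\<forall>w. \<not> w permutes {1..N} \<longrightarrow> c w = 0"
    "IdC_eq N \<beta> P (\<Sum>w | w permutes {1..N}. scalar (c w) * e_perm N w)"
    using IdC_spanned_by_e_perm[OF P] by blast
  have "IdC_coords N \<beta> P = c"
    unfolding IdC_coords_def IdC_class_eq_iff[OF P carr]
  proof (rule the_equality)
    show "(\<forall>w. \<not> w permutes {1..N} \<longrightarrow> c w = 0) \<and>
      IdC_eq N \<beta> P (\<Sum>w | w permutes {1..N}. scalar (c w) * e_perm N w)" using c by blast
    fix d assume d: "(\<forall>w. \<not> w permutes {1..N} \<longrightarrow> d w = 0) \<and>
      IdC_eq N \<beta> P (\<Sum>w | w permutes {1..N}. scalar (d w) * e_perm N w)"
    show "d = c"
    proof (rule ext)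
      fix w show "d w = c w"
        using val[of c w] val[of d w] c d by (cases "w permutes {1..N}") auto
    qed
  qed
  with val[OF c(2) v] show ?thesis by simp
qed

end

section \<open>Determinants\<close>

lemma det1_cong:
  assumes "\<And>i j. i \<in> {1..n} \<Longrightarrow> j \<in> {1..n} \<Longrightarrow> F i j = G i j"
  shows "det1 n F = det1 n G"
  unfolding det1_def by (rule arg_cong[of _ _ det], rule cong_mat) (auto intro!: assms)

lemma det1_Leibniz_columns:
  "det1 n F = (\<Sum>p | p permutes {0..<n}. signof p * (\<Prod>j<n. F (Suc (p j)) (Suc j)))"
proof -
  have "(\<Prod>j<n. mat n n (\<lambda>(i, j). F (i + 1) (j + 1)) $$ (p j, j)) = (\<Prod>j<n. F (Suc (p j)) (Suc j))"
    if "p permutes {0..<n}" for p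
  proof (rule prod.cong[OF refl])
    fix j assume j: "j \<in> {..<n}"
    then have "p j \<in> {0..<n}" using that by (simp add: permutes_in_image)
    with j show "mat n n (\<lambda>(i, j). F (i + 1) (j + 1)) $$ (p j, j) = F (Suc (p j)) (Suc j)" by simp
  qed
  then show ?thesis unfolding det1_def
    by (subst det_col[of _ n]) (auto intro!: sum.cong)
qed

lemma det1_column_linear:
  assumes c: "c \<in> {1..n}"
    and "\<And>i. i \<in> {1..n} \<Longrightarrow> H i c = F i c + a * G i c"
    and "\<And>i j. i \<in> {1..n} \<Longrightarrow> j \<in> {1..n} \<Longrightarrow> j \<noteq> c \<Longrightarrow> F i j = H i j"
    and "\<And>i j. i \<in> {1..n} \<Longrightarrow> j \<in> {1..n} \<Longrightarrow> j \<noteq> c \<Longrightarrow> G i j = H i j"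
  shows "det1 n H = det1 n F + a * det1 n G"
proof -
  have "(\<Prod>j<n. H (Suc (p j)) (Suc j)) =
      (\<Prod>j<n. F (Suc (p j)) (Suc j)) + a * (\<Prod>j<n. G (Suc (p j)) (Suc j))"
    if p: "p permutes {0..<n}" for p
  proof -
    have c': "c - 1 \<in> {..<n}" "Suc (c - 1) = c" using c by auto
    have pin: "Suc (p j) \<in> {1..n}" if "j < n" for j
      using permutes_in_image[OF p, of j] that by auto
    have "(\<Prod>j\<in>{..<n} - {c - 1}. F (Suc (p j)) (Suc j)) = (\<Prod>j\<in>{..<n} - {c - 1}. H (Suc (p j)) (Suc j))"
      "(\<Prod>j\<in>{..<n} - {c - 1}. G (Suc (p j)) (Suc j)) = (\<Prod>j\<in>{..<n} - {c - 1}. H (Suc (p j)) (Suc j))"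
      using c' pin by (auto intro!: prod.cong assms)
    then show ?thesis
      using c' pin[of "c - 1"] by (simp add: prod.remove[of _ "c - 1"] assms algebra_simps)
  qed
  then show ?thesis
    unfolding det1_Leibniz_columns sum_distrib_left sum.distrib[symmetric]
    by (intro sum.cong) (auto simp: algebra_simps)
qed

lemma det1_equal_columns:
  assumes "c \<in> {1..n}" "d \<in> {1..n}" "c \<noteq> d" "\<And>i. i \<in> {1..n} \<Longrightarrow> F i c = F i d"
  shows "det1 n F = 0"
  unfolding det1_def
proof (rule det_identical_columns[of _ n "c - 1" "d - 1"])
  show "col (mat n n (\<lambda>(i, j). F (i + 1) (j + 1))) (c - 1) = col (mat n n (\<lambda>(i, j). F (i + 1) (j + 1))) (d - 1)"
    using assms by (intro eq_vecI) auto
qed (use assms in auto)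

lemma det1_column_add:
  assumes "c \<in> {1..n}" "d \<in> {1..n}" "c \<noteq> d"
    and "\<And>i. i \<in> {1..n} \<Longrightarrow> H i c = F i c + a * F i d"
    and "\<And>i j. i \<in> {1..n} \<Longrightarrow> j \<in> {1..n} \<Longrightarrow> j \<noteq> c \<Longrightarrow> H i j = F i j"
  shows "det1 n H = det1 n F"
proof -
  define G where "G i j = (if j = c then F i d else F i j)" for i j
  have "det1 n H = det1 n F + a * det1 n G"
    by (rule det1_column_linear[OF assms(1)]) (use assms in \<open>auto simp: G_def\<close>)
  moreover have "det1 n G = 0"
    by (rule det1_equal_columns[OF assms(1-3)]) (use assms(3) in \<open>auto simp: G_def\<close>)
  ultimately show ?thesis by simp
qed

lemma det1_zero_column:
  assumes "c \<in> {1..n}" "\<And>i. i \<in> {1..n} \<Longrightarrow> F i c = 0"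
  shows "det1 n F = 0"
  using det1_column_linear[OF assms(1), of F F "- 1" F] assms by simp

lemma det1_mult: "det1 n (\<lambda>i j. \<Sum>k=1..n. F i k * G k j) = det1 n F * det1 n G"
proof -
  have "mat n n (\<lambda>(i, j). \<Sum>k=1..n. F (i + 1) k * G k (j + 1)) =
      mat n n (\<lambda>(i, j). F (i + 1) (j + 1)) * mat n n (\<lambda>(i, j). G (i + 1) (j + 1))"
  proof (rule eq_matI)
    fix i j assume ij: "i < dim_row (mat n n (\<lambda>(i, j). F (i + 1) (j + 1)) * mat n n (\<lambda>(i, j). G (i + 1) (j + 1)))"
      "j < dim_col (mat n n (\<lambda>(i, j). F (i + 1) (j + 1)) * mat n n (\<lambda>(i, j). G (i + 1) (j + 1)))"
    have "(\<Sum>k=1..n. F (i + 1) k * G k (j + 1)) = (\<Sum>k=0..<n. F (i + 1) (k + 1) * G (k + 1) (j + 1))"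
      by (rule sum.reindex_bij_witness[of _ "\<lambda>k. k + 1" "\<lambda>k. k - 1"]) auto
    then show "mat n n (\<lambda>(i, j). \<Sum>k=1..n. F (i + 1) k * G k (j + 1)) $$ (i, j) =
      (mat n n (\<lambda>(i, j). F (i + 1) (j + 1)) * mat n n (\<lambda>(i, j). G (i + 1) (j + 1))) $$ (i, j)"
      using ij by (simp add: scalar_prod_def)
  qed simp_all
  then show ?thesis unfolding det1_def
    using det_mult[of "mat n n (\<lambda>(i, j). F (i + 1) (j + 1))" n "mat n n (\<lambda>(i, j). G (i + 1) (j + 1))"] by simp
qed

lemma det1_unitriangular:
  assumes "\<And>i j. 1 \<le> i \<Longrightarrow> i < j \<Longrightarrow> j \<le> n \<Longrightarrow> F i j = 0" and "\<And>i. i \<in> {1..n} \<Longrightarrow> F i i = 1"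
  shows "det1 n F = 1"
proof -
  have "det1 n F = prod_list (diag_mat (mat n n (\<lambda>(i, j). F (i + 1) (j + 1))))"
    unfolding det1_def by (rule det_lower_triangular[of n]) (use assms in auto)
  also have "\<dots> = 1"
    unfolding prod_list_diag_prod by (rule prod.neutral) (use assms in auto)
  finally show ?thesis .
qed

text \<open>Expansion along the first column, whose only nonzero entry is in the last row; the signs add up to
  that of the reversal of $\{1,\dots,n\}$.\<close>

lemma det1_antitriangular:
  assumes "\<And>i j. 1 \<le> i \<Longrightarrow> 1 \<le> j \<Longrightarrow> i + j \<le> n \<Longrightarrow> F i j = 0"
  shows "det1 n F = (\<Prod>i=1..n. (- 1) ^ (i - 1) * F i (n + 1 - i))"
  using assms
proof (induction n arbitrary: F)
  case 0
  then show ?case by (simp add: det1_def)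
next
  case (Suc n)
  let ?A = "mat (Suc n) (Suc n) (\<lambda>(i, j). F (i + 1) (j + 1))"
  have "det1 (Suc n) F = (\<Sum>i<Suc n. ?A $$ (i, 0) * cofactor ?A i 0)"
    unfolding det1_def by (rule laplace_expansion_column) simp_all
  also have "\<dots> = ?A $$ (n, 0) * cofactor ?A n 0"
  proof -
    have "(\<Sum>i<n. ?A $$ (i, 0) * cofactor ?A i 0) = 0"
      using Suc.prems by (intro sum.neutral) auto
    then show ?thesis by simp
  qed
  also have "cofactor ?A n 0 = (- 1) ^ n * det1 n (\<lambda>i j. F i (Suc j))"
  proof -
    have "mat_delete ?A n 0 = mat n n (\<lambda>(i, j). F (i + 1) (Suc (j + 1)))"
      by (rule eq_matI) (auto simp: mat_delete_def)
    then show ?thesis by (simp add: cofactor_def det1_def)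
  qed
  also have "det1 n (\<lambda>i j. F i (Suc j)) = (\<Prod>i=1..n. (- 1) ^ (i - 1) * F i (Suc (n + 1 - i)))"
    by (rule Suc.IH) (use Suc.prems in auto)
  also have "\<dots> = (\<Prod>i=1..n. (- 1) ^ (i - 1) * F i (Suc n + 1 - i))"
    by (intro prod.cong) (auto simp: Suc_diff_le)
  finally show ?case by (simp add: algebra_simps)
qed

text \<open>The product in the shape in which \<open>det1_antitriangular\<close> delivers it.\<close>

lemma vandermonde_prod_by_rows:
  "vandermonde_prod n x = (\<Prod>i=1..n. (- 1) ^ (i - 1) * (\<Prod>l=1..<i. x i - x l))"
proof -
  have "(\<Prod>i=1..n. (- 1) ^ (i - 1) * (\<Prod>l=1..<i. x i - x l)) = (\<Prod>i=1..n. \<Prod>l=1..<i. x l - x i)"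
  proof (rule prod.cong[OF refl])
    fix i
    have "(- 1) ^ (i - 1) = (\<Prod>l=1..<i. (- 1 :: 'a))" by simp
    then show "(- 1) ^ (i - 1) * (\<Prod>l=1..<i. x i - x l) = (\<Prod>l=1..<i. x l - x i)"
      by (simp only: prod.distrib[symmetric]) simp
  qed
  also have "\<dots> = (\<Prod>(i, l)\<in>Sigma {1..n} (\<lambda>i. {1..<i}). x l - x i)"
    by (rule prod.Sigma) auto
  also have "\<dots> = vandermonde_prod n x"
    unfolding vandermonde_prod_def
    by (rule prod.reindex_bij_witness[of _ "\<lambda>(i, j). (j, i)" "\<lambda>(i, j). (j, i)"]) auto
  finally show ?thesis by simp
qed

lemma degree_prod_linear: "degree (\<Prod>l\<in>S. [:- x l, 1:] :: 'a::comm_ring_1 poly) \<le> card S"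
  and coeff_prod_linear: "coeff (\<Prod>l\<in>S. [:- x l, 1:] :: 'a::comm_ring_1 poly) (card S) = 1"
proof -
  have "degree (\<Prod>l\<in>S. [:- x l, 1:]) \<le> card S \<and> coeff (\<Prod>l\<in>S. [:- x l, 1:]) (card S) = 1"
  proof (induction S rule: infinite_finite_induct)
    case (insert a S)
    let ?P = "\<Prod>l\<in>S. [:- x l, 1:]"
    have P: "degree ?P \<le> card S" "coeff ?P (card S) = 1" using insert.IH by auto
    have "degree ([:- x a, 1:] * ?P) \<le> Suc (card S)"
      using degree_mult_le[of "[:- x a, 1:]" ?P] P(1) by simp
    moreover have "coeff ?P (Suc (card S)) = 0" using P(1) by (intro coeff_eq_0) simp
    ultimately show ?case using insert.hyps P(2) by simp
  qed simp_all
  then show "degree (\<Prod>l\<in>S. [:- x l, 1:]) \<le> card S" "coeff (\<Prod>l\<in>S. [:- x l, 1:]) (card S) = 1"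
    by blast+
qed

text \<open>The Newton polynomials $\prod_{l<s}(t - x_l)$ are monic of degree $s-1$, so replacing the powers of
  $x_i$ by their values is a unitriangular change of columns; the new matrix is antitriangular, because
  the $s$-th polynomial vanishes at $x_i$ for $i < s$.\<close>

lemma det1_Vandermonde: "det1 n (\<lambda>i j. x i ^ (n - j)) = vandermonde_prod n x"
proof -
  define P where "P s = (\<Prod>l=1..<s. [:- x l, 1:])" for s :: nat
  have deg: "degree (P s) \<le> s - 1" and lead: "coeff (P s) (s - 1) = 1" for s
    unfolding P_def using degree_prod_linear[of x "{1..<s}"] coeff_prod_linear[of x "{1..<s}"] by simp_all
  have "det1 n (\<lambda>i j. poly (P (n + 1 - j)) (x i)) =
      det1 n (\<lambda>i j. \<Sum>k=1..n. x i ^ (n - k) * coeff (P (n + 1 - j)) (n - k))"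
  proof (rule det1_cong)
    fix i j assume ij: "i \<in> {1..n}" "j \<in> {1..n}"
    then have "degree (P (n + 1 - j)) \<le> n - 1" using deg[of "n + 1 - j"] by auto
    then have "poly (P (n + 1 - j)) (x i) = (\<Sum>d\<le>n - 1. coeff (P (n + 1 - j)) d * x i ^ d)"
      unfolding poly_altdef by (intro sum.mono_neutral_left) (auto simp: coeff_eq_0)
    also have "\<dots> = (\<Sum>k=1..n. x i ^ (n - k) * coeff (P (n + 1 - j)) (n - k))"
      by (rule sum.reindex_bij_witness[of _ "\<lambda>k. n - k" "\<lambda>d. n - d"])
         (use ij in \<open>auto simp: mult.commute\<close>)
    finally show "poly (P (n + 1 - j)) (x i) = (\<Sum>k=1..n. x i ^ (n - k) * coeff (P (n + 1 - j)) (n - k))" .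
  qed
  also have "\<dots> = det1 n (\<lambda>i k. x i ^ (n - k)) * det1 n (\<lambda>k j. coeff (P (n + 1 - j)) (n - k))"
    by (rule det1_mult)
  also have "det1 n (\<lambda>k j. coeff (P (n + 1 - j)) (n - k)) = 1"
  proof (rule det1_unitriangular)
    fix k j assume "1 \<le> k" "k < j" "j \<le> n"
    then show "coeff (P (n + 1 - j)) (n - k) = 0"
      using deg[of "n + 1 - j"] by (intro coeff_eq_0) linarith
  next
    fix k assume "k \<in> {1..n}"
    then show "coeff (P (n + 1 - k)) (n - k) = 1" using lead[of "n + 1 - k"] by simp
  qed
  finally have "det1 n (\<lambda>i j. x i ^ (n - j)) = det1 n (\<lambda>i j. poly (P (n + 1 - j)) (x i))" by simp
  also have "\<dots> = det1 n (\<lambda>i j. \<Prod>l=1..<n + 1 - j. x i - x l)"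
    by (simp add: P_def poly_prod)
  also have "\<dots> = (\<Prod>i=1..n. (- 1) ^ (i - 1) * (\<Prod>l=1..<n + 1 - (n + 1 - i). x i - x l))"
    by (rule det1_antitriangular) (auto intro!: prod_zero)
  also have "\<dots> = (\<Prod>i=1..n. (- 1) ^ (i - 1) * (\<Prod>l=1..<i. x i - x l))"
    by (intro prod.cong) auto
  finally show ?thesis by (simp only: vandermonde_prod_by_rows)
qed

section \<open>The Jacobi--Trudi identity\<close>

text \<open>The generating function $\sum_r h_r t^r$ in the variables indexed by \<open>S\<close>.\<close>

definition hom_fps :: "nat set \<Rightarrow> (nat \<Rightarrow> 'a::comm_ring_1) \<Rightarrow> 'a fps" where
  "hom_fps S x = Abs_fps (\<lambda>r. \<Sum>M | set_mset M \<subseteq> S \<and> size M = r. \<Prod>i\<in>#M. x i)"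

lemma finite_multisets_of_size:
  assumes "finite S"
  shows "finite {M. set_mset M \<subseteq> S \<and> size M = r}"
proof (induction r)
  case 0
  have "{M. set_mset M \<subseteq> S \<and> size M = 0} = {{#}}" by auto
  then show ?case by simp
next
  case (Suc r)
  have "{M. set_mset M \<subseteq> S \<and> size M = Suc r} \<subseteq> (\<lambda>(a, M). add_mset a M) ` (S \<times> {M. set_mset M \<subseteq> S \<and> size M = r})"
  proof
    fix M assume M: "M \<in> {M. set_mset M \<subseteq> S \<and> size M = Suc r}"
    then obtain a M' where "M = add_mset a M'" by (auto dest!: size_eq_Suc_imp_eq_union)
    with M show "M \<in> (\<lambda>(a, M). add_mset a M) ` (S \<times> {M. set_mset M \<subseteq> S \<and> size M = r})"
      by (intro image_eqI[of _ _ "(a, M')"]) auto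
  qed
  with Suc assms show ?case by (auto intro: finite_subset)
qed

text \<open>A monomial either avoids $x_a$ or is $x_a$ times a monomial of one degree less.\<close>

lemma hom_fps_insert:
  assumes S: "finite S" and a: "a \<notin> S"
  shows "hom_fps (insert a S) x * (1 - fps_const (x a) * fps_X) = hom_fps S x"
proof (rule fps_ext)
  fix r
  let ?M = "\<lambda>S r. {M. set_mset M \<subseteq> S \<and> size M = r}"
  let ?f = "\<lambda>M. \<Prod>i\<in>#M. x i"
  show "fps_nth (hom_fps (insert a S) x * (1 - fps_const (x a) * fps_X)) r = fps_nth (hom_fps S x) r"
  proof (cases r)
    case 0
    have "?M S 0 = {{#}}" for S :: "nat set" by auto
    then show ?thesis by (simp add: 0 hom_fps_def)
  next
    case (Suc q)
    have split: "?M (insert a S) (Suc q) = ?M S (Suc q) \<union> add_mset a ` ?M (insert a S) q"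
    proof (intro equalityI subsetI)
      fix M assume M: "M \<in> ?M (insert a S) (Suc q)"
      show "M \<in> ?M S (Suc q) \<union> add_mset a ` ?M (insert a S) q"
      proof (cases "a \<in># M")
        case True
        then obtain M' where "M = add_mset a M'" by (metis mset_add)
        with M show ?thesis by auto
      next
        case False
        with M show ?thesis by auto
      qed
    qed auto
    have "(\<Sum>M\<in>?M (insert a S) (Suc q). ?f M) = (\<Sum>M\<in>?M S (Suc q). ?f M) + (\<Sum>M\<in>add_mset a ` ?M (insert a S) q. ?f M)"
      unfolding split
      by (rule sum.union_disjoint) (use S a in \<open>auto intro!: finite_multisets_of_size\<close>)
    also have "(\<Sum>M\<in>add_mset a ` ?M (insert a S) q. ?f M) = x a * (\<Sum>M\<in>?M (insert a S) q. ?f M)"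
      by (subst sum.reindex) (auto simp: inj_on_def sum_distrib_left)
    finally have rec: "fps_nth (hom_fps (insert a S) x) (Suc q) =
        fps_nth (hom_fps S x) (Suc q) + x a * fps_nth (hom_fps (insert a S) x) q"
      by (simp add: hom_fps_def)
    have "hom_fps (insert a S) x * (1 - fps_const (x a) * fps_X) =
        hom_fps (insert a S) x - fps_const (x a) * (fps_X * hom_fps (insert a S) x)"
      by (simp add: algebra_simps)
    then show ?thesis by (simp add: Suc rec)
  qed
qed

lemma hom_fps_empty: "hom_fps {} x = 1"
proof (rule fps_ext)
  fix r
  have "{M. set_mset M \<subseteq> {} \<and> size M = r} = (if r = 0 then {{#}} else {} :: nat multiset set)" by auto
  then show "fps_nth (hom_fps {} x) r = fps_nth 1 r" by (auto simp: hom_fps_def)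
qed

lemma hom_fps_prod: "finite S \<Longrightarrow> hom_fps S x * (\<Prod>l\<in>S. 1 - fps_const (x l) * fps_X) = 1"
proof (induction S rule: finite_induct)
  case empty
  show ?case by (simp add: hom_fps_empty)
next
  case (insert a S)
  then show ?case by (simp add: hom_fps_insert flip: mult.assoc)
qed

lemma fps_prod_linear_nth_0:
  assumes "finite S"
  shows "card S < d \<Longrightarrow> fps_nth (\<Prod>l\<in>S. 1 - fps_const (x l) * fps_X :: 'a::comm_ring_1 fps) d = 0"
  using assms
proof (induction S arbitrary: d rule: finite_induct)
  case (insert a S)
  then obtain e where d: "d = Suc e" by (cases d) auto
  let ?P = "\<Prod>l\<in>S. 1 - fps_const (x l) * fps_X"
  have "(1 - fps_const (x a) * fps_X) * ?P = ?P - fps_const (x a) * (fps_X * ?P)"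
    by (simp add: algebra_simps)
  then show ?case using insert d by simp
qed simp

text \<open>Comparison of coefficients in
  $\prod_{l\ne i}(1 - x_l t)\cdot\sum_r h_r t^r = (1 - x_i t)^{-1} = \sum_m x_i^m t^m$. The coefficients of the
  first factor do not depend on $m$, and only those of degree less than $n$ can be nonzero.\<close>

lemma power_expansion_complete_hom:
  fixes x :: "nat \<Rightarrow> 'a::comm_ring_1"
  assumes i: "i \<in> {1..n}"
  shows "x i ^ m = (\<Sum>k=1..n. fps_nth (\<Prod>l\<in>{1..n} - {i}. 1 - fps_const (x l) * fps_X) (n - k) *
    complete_hom n x (int m - int n + int k))"
proof -
  define u where "u = 1 - fps_const (x i) * fps_X"
  define P where "P = (\<Prod>l\<in>{1..n} - {i}. 1 - fps_const (x l) * fps_X)"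
  define G where "G = Abs_fps (\<lambda>m. x i ^ m)"
  have "G * u = 1"
  proof (rule fps_ext)
    fix r show "fps_nth (G * u) r = fps_nth 1 r"
    proof -
      have "G * u = G - fps_const (x i) * (fps_X * G)" by (simp add: u_def algebra_simps)
      then show ?thesis by (cases r) (simp_all add: G_def)
    qed
  qed
  moreover have "hom_fps {1..n} x * P * u = 1"
    using hom_fps_prod[of "{1..n}" x] i
    by (simp add: prod.remove[of _ i] u_def P_def mult_ac)
  ultimately have eq: "hom_fps {1..n} x * P = G"
    by (metis mult.assoc mult.commute mult_1_right)
  have hneg: "complete_hom n x r = 0" if "r < 0" for r
    using that by (simp add: complete_hom_def)
  have hnat: "complete_hom n x (int r) = fps_nth (hom_fps {1..n} x) r" for r
    by (simp add: complete_hom_def hom_fps_def)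
  have P0: "fps_nth P d = 0" if "n \<le> d" for d
    unfolding P_def using i that by (intro fps_prod_linear_nth_0) auto
  have "x i ^ m = fps_nth (P * hom_fps {1..n} x) m" using eq by (simp add: G_def mult.commute)
  also have "\<dots> = (\<Sum>d=0..m. fps_nth P d * complete_hom n x (int m - int d))"
    unfolding fps_mult_nth
  proof (rule sum.cong[OF refl])
    fix d assume "d \<in> {0..m}"
    then show "fps_nth P d * fps_nth (hom_fps {1..n} x) (m - d) = fps_nth P d * complete_hom n x (int m - int d)"
      using hnat[of "m - d"] by (simp add: of_nat_diff)
  qed
  also have "\<dots> = (\<Sum>d\<in>{0..<n}. fps_nth P d * complete_hom n x (int m - int d))"
  proof (rule sum.mono_neutral_cong)
    fix d assume "d \<in> {0..m} - {0..<n}"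
    then show "fps_nth P d * complete_hom n x (int m - int d) = 0" using P0[of d] by simp
  next
    fix d assume "d \<in> {0..<n} - {0..m}"
    then show "fps_nth P d * complete_hom n x (int m - int d) = 0" using hneg[of "int m - int d"] by simp
  qed simp_all
  also have "\<dots> = (\<Sum>k=1..n. fps_nth P (n - k) * complete_hom n x (int m - int n + int k))"
    by (rule sum.reindex_bij_witness[of _ "\<lambda>k. n - k" "\<lambda>d. n - d"]) (auto simp: of_nat_diff algebra_simps)
  finally show ?thesis by (simp only: P_def)
qed

text \<open>The matrix on the right is $P H$, where $P$ consists of the coefficients from
  \<open>power_expansion_complete_hom\<close> and $H$ of the $h^{(\beta)}$: expanding $(1 + \beta x_i)^{j-1}$ writes every
  entry as a combination of powers of $x_i$ with coefficients independent of $i$. For the powers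
  $x_i^{n-j}$ the same factorization has the unitriangular second factor $(h_{k-j})$, so $\det P$ is the
  Vandermonde product.\<close>

theorem det1_beta_complete_hom:
  fixes x :: "nat \<Rightarrow> 'a::comm_ring_1"
  shows "det1 n (\<lambda>i j. beta_complete_hom n \<beta> x (int (lam j) + int i) j) * vandermonde_prod n x =
    det1 n (\<lambda>i j. x i ^ (lam j + n - j) * (1 + \<beta> * x i) ^ (j - 1))"
proof -
  define P where "P i k = fps_nth (\<Prod>l\<in>{1..n} - {i}. 1 - fps_const (x l) * fps_X) (n - k)" for i k
  have pow: "x i ^ m = (\<Sum>k=1..n. P i k * complete_hom n x (int m - int n + int k))" if "i \<in> {1..n}" for i m
    unfolding P_def by (rule power_expansion_complete_hom[OF that])
  have "vandermonde_prod n x = det1 n (\<lambda>i j. \<Sum>k=1..n. P i k * complete_hom n x (int k - int j))"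
    unfolding det1_Vandermonde[symmetric]
    by (rule det1_cong) (auto simp: pow of_nat_diff algebra_simps)
  also have "\<dots> = det1 n P * det1 n (\<lambda>k j. complete_hom n x (int k - int j))"
    by (rule det1_mult)
  also have "det1 n (\<lambda>k j. complete_hom n x (int k - int j)) = 1"
  proof (rule det1_unitriangular)
    have "{M. set_mset M \<subseteq> {1..n} \<and> M = {#}} = {{#}}" by auto
    then show "complete_hom n x (int i - int i) = 1" for i by (simp add: complete_hom_def)
  qed (simp add: complete_hom_def)
  finally have V: "vandermonde_prod n x = det1 n P" by simp
  have "det1 n (\<lambda>i j. x i ^ (lam j + n - j) * (1 + \<beta> * x i) ^ (j - 1)) =
    det1 n (\<lambda>i j. \<Sum>k=1..n. P i k * beta_complete_hom n \<beta> x (int (lam j) + int k) j)"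
  proof (rule det1_cong)
    fix i j assume ij: "i \<in> {1..n}" "j \<in> {1..n}"
    have "(1 + \<beta> * x i) ^ (j - 1) = (\<Sum>a=0..j - 1. of_nat ((j - 1) choose a) * (\<beta> * x i) ^ a)"
      using binomial_ring[of "\<beta> * x i" 1 "j - 1"] by (simp add: add.commute atLeast0AtMost)
    then have "x i ^ (lam j + n - j) * (1 + \<beta> * x i) ^ (j - 1) =
        (\<Sum>a=0..j - 1. of_nat ((j - 1) choose a) * \<beta> ^ a * x i ^ (lam j + n - j + a))"
      by (simp add: sum_distrib_left power_mult_distrib power_add mult_ac)
    also have "\<dots> = (\<Sum>a=0..j - 1. \<Sum>k=1..n. P i k * (of_nat ((j - 1) choose a) *
        complete_hom n x (int (lam j) + int k - int j + int a) * \<beta> ^ a))"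
    proof (rule sum.cong[OF refl])
      fix a
      have e: "int (lam j + n - j + a) - int n + int k = int (lam j) + int k - int j + int a" for k
        using ij by (simp add: of_nat_diff)
      show "of_nat ((j - 1) choose a) * \<beta> ^ a * x i ^ (lam j + n - j + a) =
        (\<Sum>k=1..n. P i k * (of_nat ((j - 1) choose a) *
          complete_hom n x (int (lam j) + int k - int j + int a) * \<beta> ^ a))"
        unfolding pow[OF ij(1)] e by (simp add: sum_distrib_left mult_ac)
    qed
    also have "\<dots> = (\<Sum>k=1..n. P i k * beta_complete_hom n \<beta> x (int (lam j) + int k) j)"
      unfolding beta_complete_hom_def by (subst sum.swap) (simp add: sum_distrib_left)
    finally show "x i ^ (lam j + n - j) * (1 + \<beta> * x i) ^ (j - 1) =
      (\<Sum>k=1..n. P i k * beta_complete_hom n \<beta> x (int (lam j) + int k) j)" .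
  qed
  also have "\<dots> = det1 n P * det1 n (\<lambda>i j. beta_complete_hom n \<beta> x (int (lam j) + int i) j)"
    by (rule det1_mult)
  finally show ?thesis by (simp add: V mult.commute)
qed

section \<open>Grassmannian permutations\<close>

definition grassmannian :: "nat \<Rightarrow> nat \<Rightarrow> (nat \<Rightarrow> nat) \<Rightarrow> bool" where
  "grassmannian N n w \<longleftrightarrow>
     w permutes {1..N} \<and> strict_mono_on {1..n} w \<and> strict_mono_on {n<..N} w"

lemma increasing_values_unique:
  fixes w v :: "nat \<Rightarrow> nat"
  assumes "strict_mono_on {n<..N} w" "strict_mono_on {n<..N} v" "w ` {n<..N} = v ` {n<..N}"
    and "i \<in> {n<..N}"
  shows "w i = v i"
proof -
  let ?L = "[Suc n..<Suc N]"
  have sd: "sorted (map u ?L) \<and> distinct (map u ?L)" if u: "strict_mono_on {n<..N} u" for u :: "nat \<Rightarrow> nat"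
  proof -
    have "sorted_wrt (\<lambda>a b. u a < u b) ?L"
      using u by (intro sorted_wrt_mono_rel[OF _ sorted_wrt_upt]) (auto simp: strict_mono_on_def)
    then have "sorted_wrt (<) (map u ?L)" by (simp add: sorted_wrt_map)
    then show ?thesis by (simp add: strict_sorted_iff)
  qed
  have set: "set ?L = {n<..N}" by auto
  have "map w ?L = map v ?L"
    using sd[OF assms(1)] sd[OF assms(2)] assms(3) set
    by (intro sorted_distinct_set_unique) (simp_all del: upt_Suc)
  then show ?thesis using assms(4) set by (metis map_eq_conv)
qed

lemma ex_increasing_enumeration:
  assumes "finite B" "card B = N - n"
  shows "\<exists>v :: nat \<Rightarrow> nat. strict_mono_on {n<..N} v \<and> v ` {n<..N} = B"
proof (intro exI conjI)
  let ?v = "\<lambda>i. sorted_list_of_set B ! (i - Suc n)"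
  show "strict_mono_on {n<..N} ?v"
  proof (rule strict_mono_onI)
    fix a b assume "a \<in> {n<..N}" "b \<in> {n<..N}" "a < b"
    then show "?v a < ?v b"
      using assms by (intro sorted_wrt_nth_less[OF strict_sorted_list_of_set]) auto
  qed
  show "?v ` {n<..N} = B"
  proof -
    have "?v ` {n<..N} = (\<lambda>i. sorted_list_of_set B ! i) ` {..<N - n}"
    proof (intro equalityI subsetI)
      fix b assume "b \<in> (\<lambda>i. sorted_list_of_set B ! i) ` {..<N - n}"
      then obtain i where "i < N - n" "b = sorted_list_of_set B ! i" by blast
      then show "b \<in> ?v ` {n<..N}" by (intro image_eqI[of _ _ "i + Suc n"]) auto
    qed auto
    also have "\<dots> = set (sorted_list_of_set B)"
      using assms by (auto simp: set_conv_nth)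
    finally show ?thesis using assms by simp
  qed
qed

text \<open>The prescribed values on $\{1,\dots,n\}$ are increasing and at most $N$, and the remaining values can be
  listed in increasing order in exactly one way; hence the description of $\sigma_\lambda$ has a unique
  solution, and it has these properties.\<close>

lemma grassmannian_perm_props:
  assumes part: "is_partition n lam" and N: "n + lam 1 \<le> N"
  defines "w \<equiv> grassmannian_perm N n lam"
  shows "grassmannian N n w" "\<And>i. i \<in> {1..n} \<Longrightarrow> w i = i + lam (n + 1 - i)"
proof -
  define f where "f i = i + lam (n + 1 - i)" for i
  have f_mono: "strict_mono_on {1..n} f"
  proof (rule strict_mono_onI)
    fix a b assume ab: "a \<in> {1..n}" "b \<in> {1..n}" "a < b"
    have "lam (n + 1 - a) \<le> lam (n + 1 - b)"
      by (rule part[unfolded is_partition_def, rule_format]) (use ab in auto)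
    with ab show "f a < f b" by (simp add: f_def)
  qed
  have f_range: "f ` {1..n} \<subseteq> {1..N}"
  proof
    fix b assume "b \<in> f ` {1..n}"
    then obtain a where a: "a \<in> {1..n}" "b = f a" by blast
    have "lam (n + 1 - a) \<le> lam 1"
      by (rule part[unfolded is_partition_def, rule_format]) (use a in auto)
    with a N show "b \<in> {1..N}" by (auto simp: f_def)
  qed
  let ?P = "\<lambda>w. w permutes {1..N} \<and> (\<forall>i\<in>{1..n}. w i = i + lam (n + 1 - i)) \<and> strict_mono_on {n<..N} w"
  have inj_f: "inj_on f {1..n}" by (rule strict_mono_on_imp_inj_on[OF f_mono])
  have nN: "n \<le> N" using N by simp
  define B where "B = {1..N} - f ` {1..n}"
  have "card B = N - n"
    unfolding B_def using f_range inj_f by (subst card_Diff_subset) (auto simp: card_image)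
  then obtain v :: "nat \<Rightarrow> nat" where v: "strict_mono_on {n<..N} v" "v ` {n<..N} = B"
    using ex_increasing_enumeration[of B N n] unfolding B_def by auto
  define u where "u i = (if i \<in> {1..n} then f i else if i \<in> {n<..N} then v i else i)" for i
  have dom: "{1..N} = {1..n} \<union> {n<..N}" using nN by auto
  have img: "u ` {1..n} = f ` {1..n}" "u ` {n<..N} = B"
    using v(2) by (auto simp: u_def image_iff)
  have "bij_betw u {1..N} {1..N}"
  proof -
    have "u ` {1..N} = {1..N}"
      unfolding dom image_Un img using f_range dom by (auto simp: B_def)
    then show ?thesis by (simp add: bij_betw_def eq_card_imp_inj_on)
  qed
  then have "u permutes {1..N}"
    by (rule bij_imp_permutes) (use nN in \<open>auto simp: u_def\<close>)
  moreover have "strict_mono_on {n<..N} u"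
    using v(1) by (auto simp: u_def strict_mono_on_def)
  ultimately have "?P u" by (auto simp: u_def f_def)
  moreover have "t = u" if t: "?P t" for t
  proof (rule ext)
    fix i
    have "t ` {1..n} = u ` {1..n}" using t \<open>?P u\<close> by (auto simp: image_iff)
    moreover have "s ` {n<..N} = {1..N} - s ` {1..n}" if "s permutes {1..N}" for s
    proof -
      have "s ` ({1..N} - {1..n}) = s ` {1..N} - s ` {1..n}"
        by (rule image_set_diff[OF permutes_inj[OF that]])
      moreover have "{1..N} - {1..n} = {n<..N}" by auto
      ultimately show ?thesis using permutes_image[OF that] by simp
    qed
    ultimately have im: "t ` {n<..N} = u ` {n<..N}" using t \<open>?P u\<close> by simp
    consider "i \<in> {1..n}" | "i \<in> {n<..N}" | "i \<notin> {1..N}" using nN by fastforce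
    then show "t i = u i"
    proof cases
      case 2
      then show ?thesis using increasing_values_unique[OF _ _ im] t \<open>?P u\<close> by blast
    next
      case 3
      then show ?thesis using t \<open>?P u\<close> by (metis permutes_not_in)
    qed (use t \<open>?P u\<close> in auto)
  qed
  ultimately have "w = u"
    unfolding w_def grassmannian_perm_def by (rule the_equality)
  with \<open>?P u\<close> show "grassmannian N n w" "\<And>i. i \<in> {1..n} \<Longrightarrow> w i = i + lam (n + 1 - i)"
    using f_mono by (auto simp: grassmannian_def f_def strict_mono_on_def)
qed

text \<open>Such a permutation preserves $\{1,\dots,n\}$, so it has no descent at $n$ either.\<close>

lemma grassmannian_eq_id:
  assumes g: "grassmannian N n w" and n: "n \<le> N" and le: "\<And>i. i \<in> {1..n} \<Longrightarrow> w i \<le> n"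
  shows "w = id"
proof -
  have w: "w permutes {1..N}" and mono: "strict_mono_on {1..n} w" "strict_mono_on {n<..N} w"
    using g by (auto simp: grassmannian_def)
  show ?thesis
  proof (rule permutes_no_descent[OF w])
    fix i assume i: "i \<in> {1..<N}"
    consider "i < n" | "i = n" | "n < i" by linarith
    then show "w i < w (Suc i)"
    proof cases
      case 2
      have "w ` {1..n} = {1..n}"
      proof (rule endo_inj_surj)
        show "w ` {1..n} \<subseteq> {1..n}"
        proof
          fix b assume "b \<in> w ` {1..n}"
          then obtain a where a: "a \<in> {1..n}" "b = w a" by blast
          then have "b \<in> {1..N}" using permutes_in_image[OF w, of a] n by auto
          with a le[OF a(1)] show "b \<in> {1..n}" by auto
        qed
      qed (use permutes_inj_on[OF w] in auto)
      moreover have "w (Suc n) \<notin> w ` {1..n}"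
        using permutes_inj[OF w] by (auto simp: inj_eq)
      moreover have "w (Suc n) \<in> {1..N}" using permutes_in_image[OF w, of "Suc n"] i 2 by auto
      ultimately have "n < w (Suc n)" by auto
      with 2 i le[of n] show ?thesis by force
    qed (use i mono in \<open>auto simp: strict_mono_on_def\<close>)
  qed
qed

text \<open>If $k+1$ stands to the left of $k$ in the one-line notation of a grassmannian permutation, then the two
  values lie on different sides of position $n$. Exchanging them keeps both sides increasing, so the
  grassmannian coefficients of $e_k f$ depend only on those of $f$.\<close>

lemma grassmannian_descent:
  assumes g: "grassmannian N n w" and n: "n \<le> N" and k: "k \<in> {1..<N}"
    and desc: "pinv w (Suc k) < pinv w k"
  shows "pinv w (Suc k) \<in> {1..n}" "pinv w k \<in> {n<..N}"
    and "grassmannian N n (transpose k (Suc k) \<circ> w)"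
proof -
  have w: "w permutes {1..N}" and mono: "strict_mono_on {1..n} w" "strict_mono_on {n<..N} w"
    using g by (auto simp: grassmannian_def)
  have wi: "w (pinv w y) = y" for y by (rule permutes_inverses(1)[OF w])
  have im: "pinv w (Suc k) \<in> {1..N}" "pinv w k \<in> {1..N}"
    using permutes_in_image[OF permutes_inv[OF w]] k by auto
  have 1: "\<not> (pinv w (Suc k) \<in> {1..n} \<and> pinv w k \<in> {1..n})"
    using strict_mono_onD[OF mono(1) _ _ desc] by (auto simp: wi)
  have 2: "\<not> (pinv w (Suc k) \<in> {n<..N} \<and> pinv w k \<in> {n<..N})"
    using strict_mono_onD[OF mono(2) _ _ desc] by (auto simp: wi)
  show low: "pinv w (Suc k) \<in> {1..n}" and high: "pinv w k \<in> {n<..N}"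
    using 1 2 im desc by auto
  have m1: "strict_mono_on {1..n} (transpose k (Suc k) \<circ> w)"
  proof (rule strict_mono_onI)
    fix a b assume ab: "a \<in> {1..n}" "b \<in> {1..n}" "a < b"
    have "w a < w b" by (rule strict_mono_onD[OF mono(1) ab])
    moreover have "w a \<noteq> k" "w b \<noteq> k"
      using ab high permutes_inverses(2)[OF w, of a] permutes_inverses(2)[OF w, of b] by auto
    ultimately show "(transpose k (Suc k) \<circ> w) a < (transpose k (Suc k) \<circ> w) b"
      by (auto simp: transpose_def)
  qed
  have m2: "strict_mono_on {n<..N} (transpose k (Suc k) \<circ> w)"
  proof (rule strict_mono_onI)
    fix a b assume ab: "a \<in> {n<..N}" "b \<in> {n<..N}" "a < b"
    have "w a < w b" by (rule strict_mono_onD[OF mono(2) ab])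
    moreover have "w a \<noteq> Suc k" "w b \<noteq> Suc k"
      using ab low permutes_inverses(2)[OF w, of a] permutes_inverses(2)[OF w, of b] by auto
    ultimately show "(transpose k (Suc k) \<circ> w) a < (transpose k (Suc k) \<circ> w) b"
      by (auto simp: transpose_def)
  qed
  show "grassmannian N n (transpose k (Suc k) \<circ> w)"
    using m1 m2 simple_transposition_comp_permutes[OF w k] by (simp add: grassmannian_def)
qed

section \<open>Evolution of the grassmannian coefficients\<close>

lemma carrier_prod_list:
  "(\<And>P. P \<in> set Ps \<Longrightarrow> P \<in> carrier (free_algebra N)) \<Longrightarrow> prod_list Ps \<in> carrier (free_algebra N)"
  by (induction Ps) (auto intro!: carrier_closed)

lemma carrier_h_gen: "k \<in> {1..<N} \<Longrightarrow> h_gen k z \<in> carrier (free_algebra N)"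
  by (auto simp: h_gen_def intro!: carrier_closed)

lemma carrier_double_product:
  "prod_list (map (\<lambda>i. prod_list (map (\<lambda>j. h_gen (i + j - 1) (z i j)) (rev [1..<N - i + 1]))) [1..<N])
    \<in> carrier (free_algebra N)"
  by (auto intro!: carrier_prod_list carrier_h_gen) linarith+

text \<open>For grassmannian \<open>w\<close>, in column $j$ the value $w(n+1-j)$, that is the $j$-th largest of the first $n$ values of \<open>w\<close>,
  selects the column of \<open>\<phi>\<close>, while the power of \<open>b\<close> depends on the rank $j$.\<close>

definition grass_det ::
    "nat \<Rightarrow> (nat \<Rightarrow> 'a::comm_ring_1) \<Rightarrow> (nat \<Rightarrow> nat \<Rightarrow> 'a) \<Rightarrow> (nat \<Rightarrow> nat) \<Rightarrow> 'a" where
  "grass_det n b \<phi> w = det1 n (\<lambda>i j. \<phi> i (w (n + 1 - j)) * b i ^ (j - 1))"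

text \<open>The local step. If passing from \<open>\<phi>\<close> to \<open>\<psi>\<close> changes only the column \<open>k + 1\<close>, by the stated multiple of
  the column \<open>k\<close>, then the determinants change as the coefficients do under $1 + t u e_k$. If \<open>k + 1\<close> is
  not among the first $n$ values of \<open>w\<close>, nothing changes on either side. If \<open>k + 1\<close> is but \<open>k\<close> is not, the
  determinant is linear in the column that changes, and $b_i = u\,(1 + \beta r_i)$ splits the change into
  the terms of $s_k w$ and $\beta w$. If both are, their columns are adjacent, the
  factor \<open>b i\<close> makes up for the shift of the rank by one, and the change is a multiple of the neighbouring
  column; this matches the vanishing of the contribution of $e_k$.\<close>

lemma grass_det_step:
  fixes b :: "nat \<Rightarrow> 'a::comm_ring_1"
  assumes g: "grassmannian N n w" and n: "n \<le> N" and k: "k \<in> {1..<N}"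
    and same: "\<And>i s. i \<in> {1..n} \<Longrightarrow> s \<in> {1..N} \<Longrightarrow> s \<noteq> Suc k \<Longrightarrow> \<psi> i s = \<phi> i s"
    and old: "\<And>i. i \<in> {1..n} \<Longrightarrow> \<phi> i (Suc k) = r i * \<phi> i k"
    and new: "\<And>i. i \<in> {1..n} \<Longrightarrow> \<psi> i (Suc k) = (r i + b i * t) * \<phi> i k"
    and b: "\<And>i. i \<in> {1..n} \<Longrightarrow> u * (1 + \<beta> * r i) = b i"
  shows "grass_det n b \<psi> w = grass_det n b \<phi> w +
    t * u * (if pinv w (Suc k) < pinv w k
      then grass_det n b \<phi> (transpose k (Suc k) \<circ> w) + \<beta> * grass_det n b \<phi> w else 0)"
proof -
  have w: "w permutes {1..N}" and mono: "strict_mono_on {1..n} w" "strict_mono_on {n<..N} w"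
    using g by (auto simp: grassmannian_def)
  define q where "q = pinv w (Suc k)"
  define p where "p = pinv w k"
  have wq: "w q = Suc k" and wp: "w p = k"
    unfolding q_def p_def by (rule permutes_inverses(1)[OF w])+
  have wk: "w a = k \<longleftrightarrow> a = p" "w a = Suc k \<longleftrightarrow> a = q" for a
    using wq wp permutes_inj[OF w] by (metis injD)+
  have range: "q \<in> {1..N}" "p \<in> {1..N}"
    unfolding q_def p_def using permutes_in_image[OF permutes_inv[OF w]] k by auto
  have win: "w (n + 1 - j) \<in> {1..N}" if "j \<in> {1..n}" for j
    using permutes_in_image[OF w, of "n + 1 - j"] that n by auto
  \<comment> \<open>columns are numbered from the right: position \<open>q\<close> of \<open>w\<close> is column \<open>n + 1 - q\<close>\<close>
  have neq: "w (n + 1 - j) \<noteq> Suc k" if "j \<in> {1..n}" "j \<noteq> n + 1 - q" for j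
    using that by (auto simp: wk)
  have unch: "\<psi> i (w (n + 1 - j)) = \<phi> i (w (n + 1 - j))"
    if "i \<in> {1..n}" "j \<in> {1..n}" "j \<noteq> n + 1 - q" for i j
    using same[OF that(1) win[OF that(2)] neq[OF that(2,3)]] .
  show ?thesis
  proof (cases "q < p")
    case True
    then have desc: "pinv w (Suc k) < pinv w k" by (simp add: p_def q_def)
    from grassmannian_descent[OF g n k desc] have q: "q \<in> {1..n}" and p: "p \<in> {n<..N}"
      by (simp_all add: p_def q_def)
    define c where "c = n + 1 - q"
    have c: "c \<in> {1..n}" "n + 1 - c = q" using q by (auto simp: c_def)
    have swap: "transpose k (Suc k) (w (n + 1 - j)) = w (n + 1 - j)" if "j \<in> {1..n}" "j \<noteq> c" for j
      using neq[OF that(1)] that p unfolding c_def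
      by (intro transpose_apply_other) (auto simp: wk)
    \<comment> \<open>the column that arises from $s_k w$ and $\beta w$ together\<close>
    define T where "T i j = (if j = c
      then \<phi> i k * b i ^ (c - 1) + \<beta> * (\<phi> i (Suc k) * b i ^ (c - 1))
      else \<phi> i (w (n + 1 - j)) * b i ^ (j - 1))" for i j
    have 1: "det1 n T = grass_det n b \<phi> (transpose k (Suc k) \<circ> w) + \<beta> * grass_det n b \<phi> w"
      unfolding grass_det_def
      by (rule det1_column_linear[OF c(1)]) (use c(2) wq swap in \<open>auto simp: T_def\<close>)
    have "grass_det n b \<psi> w = grass_det n b \<phi> w + t * u * det1 n T"
      unfolding grass_det_def
    proof (rule det1_column_linear[OF c(1)])
      fix i assume i: "i \<in> {1..n}"
      have "\<psi> i (Suc k) = r i * \<phi> i k + t * (u * (1 + \<beta> * r i)) * \<phi> i k"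
        unfolding new[OF i] b[OF i] by (simp add: algebra_simps)
      then show "\<psi> i (w (n + 1 - c)) * b i ^ (c - 1) =
          \<phi> i (w (n + 1 - c)) * b i ^ (c - 1) + t * u * T i c"
        unfolding T_def c(2) wq old[OF i] by (simp add: algebra_simps)
    qed (use unch in \<open>auto simp: T_def c_def\<close>)
    with 1 desc show ?thesis by simp
  next
    case False
    then have nodesc: "\<not> pinv w (Suc k) < pinv w k" by (simp add: p_def q_def)
    have "p \<noteq> q" using wp wq by auto
    with False have pq: "p < q" by simp
    have "grass_det n b \<psi> w = grass_det n b \<phi> w"
    proof (cases "q \<le> n")
      case False
      then show ?thesis unfolding grass_det_def
        by (intro det1_cong) (use unch in auto)
    next
      case True
      have "\<not> p + 1 < q"
      proof
        assume "p + 1 < q"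
        then have "w p < w (p + 1)" "w (p + 1) < w q"
          using True range by (auto intro!: strict_mono_onD[OF mono(1)])
        with wp wq show False by simp
      qed
      with pq have q: "q = Suc p" by simp
      define c where "c = n + 1 - q"
      have c: "c \<in> {1..n}" "n + 1 - c = q" "Suc c \<in> {1..n}" "n + 1 - Suc c = p"
        using True range q by (auto simp: c_def)
      show ?thesis unfolding grass_det_def
      proof (rule det1_column_add[OF c(1,3)])
        fix i assume i: "i \<in> {1..n}"
        have power: "b i ^ (Suc c - 1) = b i * b i ^ (c - 1)"
          using c(1) by (cases c) auto
        show "\<psi> i (w (n + 1 - c)) * b i ^ (c - 1) =
            \<phi> i (w (n + 1 - c)) * b i ^ (c - 1) + t * (\<phi> i (w (n + 1 - Suc c)) * b i ^ (Suc c - 1))"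
          unfolding c(2,4) wq wp new[OF i] old[OF i] power by (simp add: algebra_simps)
      qed (use unch in \<open>auto simp: c_def\<close>)
    qed
    with nodesc show ?thesis by simp
  qed
qed

context
  fixes n N :: nat and \<beta> :: "'k::field" and x y :: "nat \<Rightarrow> 'k"
  assumes n: "n \<le> N" and unit: "\<And>i. i \<in> {1..n} \<Longrightarrow> 1 + \<beta> * x i \<noteq> 0"
begin

text \<open>The following quantities describe the state of the computation after the rows $i > m$ of the product
  and the first $j$ factors, counted from the right, of row $m$ have been applied to $1$.\<close>

definition row_unit :: "nat \<Rightarrow> 'k" where "row_unit i = 1 + \<beta> * x i"

text \<open>The difference $x_i \ominus x_l$ for the formal group law $\oplus$.\<close>

definition ominus :: "nat \<Rightarrow> nat \<Rightarrow> 'k" where "ominus i l = (x i - x l) / row_unit l"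

text \<open>The $\beta$-analogue of the factorial power, with \<open>s - 1\<close> factors.\<close>

definition factorial_power :: "nat \<Rightarrow> nat \<Rightarrow> 'k" where
  "factorial_power i s = (\<Prod>a=1..<s. oplus \<beta> (x i) (y a))"

text \<open>The column \<open>s\<close> of the matrix that represents the state \<open>(m, j)\<close>. The final state, $m = j = 0$, has the
  factorial powers of the theorem. A row of operators that has not yet been applied costs a factor
  $x_i \ominus x_l$ and a shift of \<open>s\<close> by one; in row \<open>m\<close> the factors applied so far have reached the
  columns up to \<open>m + j\<close>. The formula is forced by the hypotheses of \<open>grass_det_step\<close>.\<close>

definition entry :: "nat \<Rightarrow> nat \<Rightarrow> nat \<Rightarrow> nat \<Rightarrow> 'k" where
  "entry m j i s =
     (if s \<le> m then \<Prod>l=1..<s. ominus i l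
      else if s \<le> m + j then (\<Prod>l=1..<m. ominus i l) * factorial_power i (s - m + 1)
      else (\<Prod>l=1..m. ominus i l) * factorial_power i (s - m))"

text \<open>The rightmost \<open>j\<close> factors of row \<open>m\<close>.\<close>

definition row_block :: "nat \<Rightarrow> nat \<Rightarrow> fword \<Rightarrow>\<^sub>0 'k" where
  "row_block m j = prod_list (map (\<lambda>j. h_gen (m + j - 1) (oplus \<beta> (x m) (y j))) (rev [1..<Suc j]))"

definition rows_from :: "nat \<Rightarrow> (nat \<Rightarrow> nat) \<Rightarrow> 'k" where
  "rows_from m = free_act \<beta> (prod_list (map (\<lambda>i. row_block i (N - i)) [m..<N])) delta_id"

text \<open>The invariant of the computation, multiplied by the Vandermonde product because the coefficients are
  determinants only up to this denominator.\<close>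

definition represents :: "((nat \<Rightarrow> nat) \<Rightarrow> 'k) \<Rightarrow> (nat \<Rightarrow> nat \<Rightarrow> 'k) \<Rightarrow> bool" where
  "represents C \<phi> \<longleftrightarrow> (\<forall>w. grassmannian N n w \<longrightarrow>
     C (pinv w) * vandermonde_prod n x = grass_det n row_unit \<phi> w)"

lemma row_block_Suc:
  "free_act \<beta> (row_block m (Suc j)) C =
   (\<lambda>p. free_act \<beta> (row_block m j) C p
      + oplus \<beta> (x m) (y (Suc j)) * hecke_op \<beta> (m + j) (free_act \<beta> (row_block m j) C) p)"
  by (simp add: row_block_def free_act_mult free_act_h_gen)

lemma row_block_0: "free_act \<beta> (row_block m 0) C = C"
  by (simp add: row_block_def)

lemma rows_from_step:
  assumes "m \<le> N"
  shows "rows_from m = free_act \<beta> (row_block m (N - m)) (rows_from (Suc m))"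
proof (cases "m = N")
  case True
  then show ?thesis by (simp add: rows_from_def row_block_0)
next
  case False
  with assms have "[m..<N] = m # [Suc m..<N]" by (intro upt_conv_Cons) simp
  then show ?thesis by (simp add: rows_from_def free_act_mult)
qed

text \<open>The factor $1 + z_m e_k$ with $z_i = x_i \oplus y_{j+1}$ and $k = m + j$ fits \<open>grass_det_step\<close> because of
  $z_i = (x_i \ominus x_m) + (1 + \beta x_i)\, z_m / (1 + \beta x_m)$ and
  $(1 + \beta x_m)(1 + \beta (x_i \ominus x_m)) = 1 + \beta x_i$.\<close>

lemma represents_step:
  assumes m: "1 \<le> m" "m \<le> n" and j: "m + j < N" and C: "represents C (entry m j)"
  shows "represents (\<lambda>p. C p + oplus \<beta> (x m) (y (Suc j)) * hecke_op \<beta> (m + j) C p) (entry m (Suc j))"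
  unfolding represents_def
proof (intro allI impI)
  fix w assume g: "grassmannian N n w"
  then have w: "w permutes {1..N}" by (simp add: grassmannian_def)
  let ?k = "m + j" and ?z = "oplus \<beta> (x m) (y (Suc j))"
  define u where "u = row_unit m"
  have u: "u \<noteq> 0" using unit[of m] m by (simp add: u_def row_unit_def)
  have k: "?k \<in> {1..<N}" using m j by simp
  have P: "entry m j i ?k = (\<Prod>l=1..<m. ominus i l) * factorial_power i (Suc j)" for i
    by (cases j) (auto simp: entry_def factorial_power_def)
  have last: "(\<Prod>l=1..m. ominus i l) = (\<Prod>l=1..<m. ominus i l) * ominus i m" for i
  proof -
    have "{1..m} = insert m {1..<m}" using m(1) by auto
    then show ?thesis by (simp add: mult.commute)
  qed
  have step: "grass_det n row_unit (entry m (Suc j)) w = grass_det n row_unit (entry m j) w +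
    ?z / u * u * (if pinv w (Suc ?k) < pinv w ?k
      then grass_det n row_unit (entry m j) (transpose ?k (Suc ?k) \<circ> w) + \<beta> * grass_det n row_unit (entry m j) w else 0)"
  proof (rule grass_det_step[OF g n k, where r = "\<lambda>i. ominus i m"])
    fix i s :: nat assume "s \<noteq> Suc ?k"
    then show "entry m (Suc j) i s = entry m j i s" by (auto simp: entry_def)
  next
    fix i
    show "entry m j i (Suc ?k) = ominus i m * entry m j i ?k"
      unfolding P by (simp add: entry_def last del: One_nat_def)
    show "u * (1 + \<beta> * ominus i m) = row_unit i"
      using u by (simp add: ominus_def u_def[symmetric] field_simps) (simp add: u_def row_unit_def algebra_simps)
    have "oplus \<beta> (x i) (y (Suc j)) = ominus i m + row_unit i * (?z / u)"
      using u by (simp add: ominus_def u_def[symmetric] field_simps)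
        (simp add: u_def row_unit_def oplus_def algebra_simps)
    then show "entry m (Suc j) i (Suc ?k) = (ominus i m + row_unit i * (?z / u)) * entry m j i ?k"
      unfolding P by (simp add: entry_def factorial_power_def)
  qed
  have Cg: "C (pinv v) * vandermonde_prod n x = grass_det n row_unit (entry m j) v" if "grassmannian N n v" for v
    using C that by (simp add: represents_def)
  show "(C (pinv w) + ?z * hecke_op \<beta> ?k C (pinv w)) * vandermonde_prod n x
      = grass_det n row_unit (entry m (Suc j)) w"
  proof (cases "pinv w (Suc ?k) < pinv w ?k")
    case True
    have "C (pinv w \<circ> transpose ?k (Suc ?k)) * vandermonde_prod n x
        = grass_det n row_unit (entry m j) (transpose ?k (Suc ?k) \<circ> w)"
      using Cg[OF grassmannian_descent(3)[OF g n k True]]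
      by (simp only: inv_simple_transposition_comp[OF w])
    with True step u show ?thesis
      by (simp add: hecke_op_def Cg[OF g, symmetric] algebra_simps)
  next
    case False
    with step show ?thesis by (simp add: hecke_op_def Cg[OF g])
  qed
qed

lemma represents_row_block:
  assumes m: "1 \<le> m" "m \<le> n" and C: "represents C (entry m 0)" and j: "m + j \<le> N"
  shows "represents (free_act \<beta> (row_block m j) C) (entry m j)"
  using j
proof (induction j)
  case 0
  then show ?case using C by (simp add: row_block_0)
next
  case (Suc j)
  then show ?case unfolding row_block_Suc by (intro represents_step[OF m]) auto
qed

text \<open>A completed row leaves the state in which the next row has not been started.\<close>

lemma entry_full_row:
  assumes "1 \<le> m" "m \<le> N" "s \<in> {1..N}"
  shows "entry m (N - m) i s = entry (m - 1) 0 i s"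
proof -
  have "{1..m - 1} = {1..<m}" "m - 1 \<le> s \<Longrightarrow> s - (m - 1) = s - m + 1 \<or> s = m - 1" using assms by auto
  then show ?thesis using assms
    by (auto simp: entry_def factorial_power_def Suc_diff_le intro!: arg_cong2[of _ _ _ _ "(*)"])
qed

lemma represents_cong:
  assumes "represents C \<phi>" "\<And>i s. i \<in> {1..n} \<Longrightarrow> s \<in> {1..N} \<Longrightarrow> \<phi> i s = \<psi> i s"
  shows "represents C \<psi>"
proof -
  have "grass_det n row_unit \<phi> w = grass_det n row_unit \<psi> w" if "grassmannian N n w" for w
  proof -
    have "w (n + 1 - j) \<in> {1..N}" if "j \<in> {1..n}" for j
      using permutes_in_image[of w "{1..N}" "n + 1 - j"] that n \<open>grassmannian N n w\<close>
      by (auto simp: grassmannian_def)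
    then show ?thesis unfolding grass_det_def by (intro det1_cong) (simp add: assms(2))
  qed
  with assms(1) show ?thesis by (simp add: represents_def)
qed

text \<open>The rows $i > n$ only involve $e_k$ with $k > n$. A descent of a grassmannian permutation at such a $k$
  requires the value \<open>k + 1\<close> among the first $n$ positions, which neither the identity nor $s_k$
  satisfies.\<close>

lemma rows_beyond_descent:
  assumes g: "grassmannian N n w" and m: "n < m" "m \<le> N"
  shows "rows_from m (pinv w) = delta_id (pinv w)"
  using m(2,1) g
proof (induction m arbitrary: w rule: inc_induct)
  case base
  show ?case by (simp add: rows_from_def)
next
  case (step m)
  have "free_act \<beta> (row_block m j) (rows_from (Suc m)) (pinv v) = delta_id (pinv v)"
    if "grassmannian N n v" "m + j \<le> N" for v j
    using that
  proof (induction j arbitrary: v)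
    case 0
    then show ?case using step by (simp add: row_block_0)
  next
    case (Suc j)
    let ?C = "free_act \<beta> (row_block m j) (rows_from (Suc m))"
    let ?s = "transpose (m + j) (Suc (m + j))"
    have v: "v permutes {1..N}" using Suc.prems by (simp add: grassmannian_def)
    have k: "m + j \<in> {1..<N}" using Suc.prems step.prems by simp
    have "hecke_op \<beta> (m + j) ?C (pinv v) = 0"
    proof (cases "pinv v (Suc (m + j)) < pinv v (m + j)")
      case True
      note d = grassmannian_descent[OF Suc.prems(1) n k True]
      have "pinv v \<noteq> id" using True by auto
      moreover have "pinv (?s \<circ> v) \<noteq> id"
      proof
        assume "pinv (?s \<circ> v) = id"
        then have "pinv v \<circ> ?s = id" by (simp only: inv_simple_transposition_comp[OF v])
        then have "pinv v (?s (m + j)) = m + j" by (metis comp_apply id_apply)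
        with d(1) step.prems show False by simp
      qed
      ultimately show ?thesis
        using Suc.IH[OF d(3)] Suc.IH[OF Suc.prems(1)] Suc.prems(2)
        by (simp add: hecke_op_def delta_id_def inv_simple_transposition_comp[OF v] del: o_apply)
    qed (simp add: hecke_op_def)
    then show ?case unfolding row_block_Suc using Suc by simp
  qed
  from this[of w "N - m"] show ?case using step by (simp add: rows_from_step[of m])
qed

text \<open>The initial state. For \<open>m = n\<close> all columns beyond $n$ vanish, since they contain the factor
  $x_i \ominus x_i$, and this leaves only the identity permutation. For the identity the matrix is
  antitriangular, the denominators of the $x_i \ominus x_l$ cancel against the powers of $1 + \beta x_i$, and the
  numerators form the Vandermonde product.\<close>

lemma represents_delta: "represents delta_id (entry n 0)"
  unfolding represents_def
proof (intro allI impI)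
  fix w assume g: "grassmannian N n w"
  then have w: "w permutes {1..N}" by (simp add: grassmannian_def)
  show "delta_id (pinv w) * vandermonde_prod n x = grass_det n row_unit (entry n 0) w"
  proof (cases "w = id")
    case False
    then obtain p where p: "p \<in> {1..n}" "n < w p"
      using grassmannian_eq_id[OF g n] by force
    have zero: "entry n 0 i (w (n + 1 - (n + 1 - p))) * row_unit i ^ (n + 1 - p - 1) = 0" if i: "i \<in> {1..n}" for i
    proof -
      have "(\<Prod>l=1..n. ominus i l) = 0"
        by (rule prod_zero) (use i in \<open>auto simp: ominus_def\<close>)
      then show ?thesis using p by (simp add: entry_def)
    qed
    have "grass_det n row_unit (entry n 0) w = 0"
      unfolding grass_det_def
      by (rule det1_zero_column[of "n + 1 - p"]) (use p zero in auto)
    moreover have "pinv w \<noteq> id" using False permutes_inv_inv[OF w] by (metis inv_id)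
    ultimately show ?thesis by (simp add: delta_id_def)
  next
    case True
    have "grass_det n row_unit (entry n 0) w =
        (\<Prod>i=1..n. (- 1) ^ (i - 1) * (entry n 0 i (w (n + 1 - (n + 1 - i))) * row_unit i ^ (n + 1 - i - 1)))"
      unfolding grass_det_def
    proof (rule det1_antitriangular)
      fix i j :: nat assume ij: "1 \<le> i" "1 \<le> j" "i + j \<le> n"
      then have "(\<Prod>l=1..<n + 1 - j. ominus i l) = 0"
        by (intro prod_zero) (auto simp: ominus_def intro!: bexI[of _ i])
      with ij show "entry n 0 i (w (n + 1 - j)) * row_unit i ^ (j - 1) = 0"
        by (simp add: entry_def True)
    qed
    also have "\<dots> = (\<Prod>i=1..n. ((- 1) ^ (i - 1) * (\<Prod>l=1..<i. x i - x l)) *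
        (row_unit i ^ (n - i) / (\<Prod>l=1..<i. row_unit l)))"
    proof (rule prod.cong[OF refl])
      fix i assume "i \<in> {1..n}"
      then show "(- 1) ^ (i - 1) * (entry n 0 i (w (n + 1 - (n + 1 - i))) * row_unit i ^ (n + 1 - i - 1)) =
        ((- 1) ^ (i - 1) * (\<Prod>l=1..<i. x i - x l)) * (row_unit i ^ (n - i) / (\<Prod>l=1..<i. row_unit l))"
        by (simp add: True entry_def ominus_def prod_dividef)
    qed
    also have "\<dots> = vandermonde_prod n x *
        ((\<Prod>i=1..n. row_unit i ^ (n - i)) / (\<Prod>i=1..n. \<Prod>l=1..<i. row_unit l))"
      by (simp only: prod.distrib prod_dividef vandermonde_prod_by_rows)
    also have "(\<Prod>i=1..n. \<Prod>l=1..<i. row_unit l) = (\<Prod>l=1..n. row_unit l ^ (n - l))"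
    proof -
      have "(\<Prod>i=1..n. \<Prod>l=1..<i. row_unit l) = (\<Prod>i=1..n. \<Prod>l | l \<in> {1..n} \<and> l < i. row_unit l)"
        by (intro prod.cong) auto
      also have "\<dots> = (\<Prod>l=1..n. \<Prod>i | i \<in> {1..n} \<and> l < i. row_unit l)"
        by (rule prod.swap_restrict) auto
      also have "\<dots> = (\<Prod>l=1..n. row_unit l ^ (n - l))"
      proof (rule prod.cong[OF refl])
        fix l assume "l \<in> {1..n}"
        then have "{i. i \<in> {1..n} \<and> l < i} = {l<..n}" by auto
        then show "(\<Prod>i | i \<in> {1..n} \<and> l < i. row_unit l) = row_unit l ^ (n - l)" by simp
      qed
      finally show ?thesis .
    qed
    also have "(\<Prod>i=1..n. row_unit i ^ (n - i)) / (\<Prod>l=1..n. row_unit l ^ (n - l)) = 1"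
      using unit by (auto simp: row_unit_def)
    finally show ?thesis
      using True by (simp add: delta_id_def del: id_apply)
  qed
qed

lemma represents_rows_from:
  assumes "1 \<le> m" "m \<le> Suc n"
  shows "represents (rows_from m) (entry (m - 1) 0)"
  using assms(2,1)
proof (induction m rule: inc_induct)
  case base
  have "rows_from (Suc n) (pinv w) = delta_id (pinv w)" if "grassmannian N n w" for w
  proof (cases "n = N")
    case True
    then show ?thesis by (simp add: rows_from_def)
  next
    case False
    with n rows_beyond_descent[OF that, of "Suc n"] show ?thesis by simp
  qed
  then show ?case using represents_delta by (simp add: represents_def)
next
  case (step m)
  have "represents (rows_from m) (entry m (N - m))"
    unfolding rows_from_step[of m, OF order.trans[OF less_Suc_eq_le[THEN iffD1, OF step.hyps(2)] n]]
    by (rule represents_row_block) (use step n in auto)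
  then show ?case
    by (rule represents_cong) (rule entry_full_row, use step n in auto)
qed

text \<open>Every partially computed product is represented by a determinant, so the complete one is; its matrix
  is \<open>entry 0 0\<close>.\<close>

theorem double_groth_grassmannian_field:
  assumes g: "grassmannian N n w"
  shows "double_groth N \<beta> x y w * vandermonde_prod n x =
    det1 n (\<lambda>i j. (\<Prod>a=1..<w (n + 1 - j). x i + y a + \<beta> * x i * y a) * (1 + \<beta> * x i) ^ (j - 1))"
proof -
  let ?P = "prod_list (map (\<lambda>i. row_block i (N - i)) [1..<N])"
  have w: "w permutes {1..N}" using g by (simp add: grassmannian_def)
  have "?P \<in> carrier (free_algebra N)"
    using carrier_double_product[of "\<lambda>i j. oplus \<beta> (x i) (y j)"] by (simp add: row_block_def)
  then have "IdC_coords N \<beta> ?P w = rows_from 1 (pinv w)"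
    by (simp add: IdC_coords_eq[OF _ w] rows_from_def)
  moreover have "double_groth N \<beta> x y w = IdC_coords N \<beta> ?P w"
    by (simp add: double_groth_def row_block_def)
  ultimately have "double_groth N \<beta> x y w * vandermonde_prod n x = grass_det n row_unit (entry 0 0) w"
    using represents_rows_from[of 1] g by (simp add: represents_def)
  also have "\<dots> = det1 n (\<lambda>i j. (\<Prod>a=1..<w (n + 1 - j). x i + y a + \<beta> * x i * y a) * (1 + \<beta> * x i) ^ (j - 1))"
    unfolding grass_det_def
  proof (rule det1_cong)
    fix i j assume "j \<in> {1..n}"
    then have "w (n + 1 - j) \<in> {1..N}" using permutes_in_image[OF w, of "n + 1 - j"] n by auto
    then show "entry 0 0 i (w (n + 1 - j)) * row_unit i ^ (j - 1) =
      (\<Prod>a=1..<w (n + 1 - j). x i + y a + \<beta> * x i * y a) * (1 + \<beta> * x i) ^ (j - 1)"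
      by (simp add: entry_def factorial_power_def oplus_def row_unit_def)
  qed
  finally show ?thesis .
qed

end

section \<open>Change of coefficient ring\<close>

context comm_ring_hom
begin

text \<open>\<open>P\<close> and \<open>Q\<close> act in the same way up to the change of coefficients \<open>hom\<close>.\<close>

definition intertwines :: "'a \<Rightarrow> (fword \<Rightarrow>\<^sub>0 'a) \<Rightarrow> (fword \<Rightarrow>\<^sub>0 'b) \<Rightarrow> bool" where
  "intertwines \<beta> P Q \<longleftrightarrow>
     (\<forall>C. free_act (hom \<beta>) Q (\<lambda>p. hom (C p)) = (\<lambda>p. hom (free_act \<beta> P C p)))"

lemma intertwines_h_gen: "intertwines \<beta> (h_gen k z) (h_gen k (hom z))"
  by (simp add: intertwines_def free_act_h_gen fun_eq_iff hecke_op_def hom_distribs)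

lemma intertwines_prod_list:
  assumes "\<And>i. i \<in> set is \<Longrightarrow> intertwines \<beta> (P i) (Q i)"
  shows "intertwines \<beta> (prod_list (map P is)) (prod_list (map Q is))"
  using assms by (induction "is") (auto simp: intertwines_def free_act_mult)

lemma hom_double_groth:
  assumes w: "w permutes {1..N}"
  shows "double_groth N (hom \<beta>) (\<lambda>i. hom (x i)) (\<lambda>i. hom (y i)) w = hom (double_groth N \<beta> x y w)"
proof -
  have oplus: "oplus (hom \<beta>) (hom a) (hom b) = hom (oplus \<beta> a b)" for a b
    by (simp add: oplus_def hom_distribs)
  let ?P = "prod_list (map (\<lambda>i. prod_list (map (\<lambda>j. h_gen (i + j - 1) (oplus \<beta> (x i) (y j)))
      (rev [1..<N - i + 1]))) [1..<N])"
  let ?Q = "prod_list (map (\<lambda>i. prod_list (map (\<lambda>j. h_gen (i + j - 1) (hom (oplus \<beta> (x i) (y j))))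
      (rev [1..<N - i + 1]))) [1..<N])"
  have "intertwines \<beta> ?P ?Q"
    by (intro intertwines_prod_list intertwines_h_gen)
  then have "free_act (hom \<beta>) ?Q (\<lambda>p. hom (delta_id p)) (pinv w) = hom (free_act \<beta> ?P delta_id (pinv w))"
    unfolding intertwines_def by (simp only: fun_eq_iff)
  moreover have "(\<lambda>p. hom (delta_id p)) = delta_id" by (auto simp: delta_id_def)
  ultimately show ?thesis
    unfolding double_groth_def oplus
    by (simp only: IdC_coords_eq[OF carrier_double_product w])
qed

lemma hom_det1: "det1 n (\<lambda>i j. hom (F i j)) = hom (det1 n F)"
proof -
  have "mat n n (\<lambda>(i, j). hom (F (i + 1) (j + 1))) = map_mat hom (mat n n (\<lambda>(i, j). F (i + 1) (j + 1)))"
    by (rule eq_matI) auto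
  then show ?thesis by (simp add: det1_def)
qed

lemma hom_vandermonde_prod: "vandermonde_prod n (\<lambda>i. hom (x i)) = hom (vandermonde_prod n x)"
  by (simp add: vandermonde_prod_def hom_prod hom_distribs case_prod_unfold)

end

section \<open>The determinantal formulas\<close>

text \<open>For $y = 0$ the factors $x_i \oplus y_j$ of row $i$ are all $x_i$, and the row is $A_i(x_i)$.\<close>

lemma groth_eq_double_groth:
  fixes x :: "nat \<Rightarrow> 'a::comm_ring_1"
  shows "groth N \<beta> x w = double_groth N \<beta> x (\<lambda>_. 0) w"
proof -
  have "A_fac N i z = prod_list (map (\<lambda>j. h_gen (i + j - 1) z) (rev [1..<N - i + 1]))" if "i < N" for i and z :: 'a
  proof -
    have "[i..<N] = map (\<lambda>j. i + j - 1) [1..<N - i + 1]"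
      using that by (intro nth_equalityI) (auto simp del: upt_Suc)
    then have "rev [i..<N] = map (\<lambda>j. i + j - 1) (rev [1..<N - i + 1])" by (simp add: rev_map del: upt_Suc)
    then show ?thesis by (simp add: A_fac_def comp_def)
  qed
  then have "map (\<lambda>i. A_fac N i (x i)) [1..<N] =
    map (\<lambda>i. prod_list (map (\<lambda>j. h_gen (i + j - 1) (oplus \<beta> (x i) 0)) (rev [1..<N - i + 1]))) [1..<N]"
    by (intro map_cong refl) (simp del: upt_Suc add: oplus_def)
  then show ?thesis by (simp only: groth_def double_groth_def)
qed

lemma comm_ring_hom_to_fract: "comm_ring_hom (to_fract :: 'a::idom \<Rightarrow> 'a fract)"
  by standard simp_all

text \<open>The invariant divides by $1 + \beta x_i$. Both sides are polynomial, so the identity descends from the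
  field of fractions.\<close>

theorem double_groth_grassmannian:
  fixes x y :: "nat \<Rightarrow> 'a::idom"
  assumes g: "grassmannian N n w" and n: "n \<le> N" and unit: "\<And>i. i \<in> {1..n} \<Longrightarrow> 1 + \<beta> * x i \<noteq> 0"
  shows "double_groth N \<beta> x y w * vandermonde_prod n x =
    det1 n (\<lambda>i j. (\<Prod>a=1..<w (n + 1 - j). x i + y a + \<beta> * x i * y a) * (1 + \<beta> * x i) ^ (j - 1))"
proof -
  interpret comm_ring_hom "to_fract :: 'a \<Rightarrow> 'a fract" by (rule comm_ring_hom_to_fract)
  have w: "w permutes {1..N}" using g by (simp add: grassmannian_def)
  have "1 + to_fract \<beta> * to_fract (x i) \<noteq> 0" if "i \<in> {1..n}" for i
  proof -
    have "1 + to_fract \<beta> * to_fract (x i) = to_fract (1 + \<beta> * x i)"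
      by (simp only: to_fract_add to_fract_mult to_fract_1)
    then show ?thesis using unit[OF that] by (simp only: to_fract_eq_0_iff not_False_eq_True)
  qed
  note field = double_groth_grassmannian_field[OF n this g, where y = "\<lambda>i. to_fract (y i)"]
  have "to_fract (double_groth N \<beta> x y w * vandermonde_prod n x) =
      double_groth N (to_fract \<beta>) (\<lambda>i. to_fract (x i)) (\<lambda>i. to_fract (y i)) w *
        vandermonde_prod n (\<lambda>i. to_fract (x i))"
    by (simp only: hom_double_groth[OF w] hom_vandermonde_prod to_fract_mult)
  also note field
  also have "det1 n (\<lambda>i j. (\<Prod>a=1..<w (n + 1 - j). to_fract (x i) + to_fract (y a) + to_fract \<beta> * to_fract (x i) * to_fract (y a))
        * (1 + to_fract \<beta> * to_fract (x i)) ^ (j - 1)) =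
      det1 n (\<lambda>i j. to_fract ((\<Prod>a=1..<w (n + 1 - j). x i + y a + \<beta> * x i * y a) * (1 + \<beta> * x i) ^ (j - 1)))"
    by (simp only: to_fract_add to_fract_mult to_fract_1 hom_prod hom_power)
  also have "\<dots> = to_fract (det1 n (\<lambda>i j. (\<Prod>a=1..<w (n + 1 - j). x i + y a + \<beta> * x i * y a) * (1 + \<beta> * x i) ^ (j - 1)))"
    by (rule hom_det1)
  finally show ?thesis by (simp only: to_fract_eq_iff)
qed

lemma one_plus_beta_xvar_nonzero: "1 + beta * xvar i \<noteq> 0"
proof -
  have "Poly_Mapping.single Beta 1 + Poly_Mapping.single (VX i) 1 \<noteq> (0 :: var \<Rightarrow>\<^sub>0 nat)"
  proof
    assume "Poly_Mapping.single Beta 1 + Poly_Mapping.single (VX i) 1 = (0 :: var \<Rightarrow>\<^sub>0 nat)"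
    from arg_cong[OF this, of "\<lambda>m. Poly_Mapping.lookup m Beta"] show False
      by (simp add: lookup_add lookup_single)
  qed
  then have "Poly_Mapping.lookup (1 + beta * xvar i) 0 = 1"
    by (simp add: lookup_add pvar_def mult_single lookup_single)
  then show ?thesis by auto
qed

lemma vandermonde_prod_xvar_nonzero: "vandermonde_prod n xvar \<noteq> 0"
proof -
  have "xvar i \<noteq> xvar j" if "i \<noteq> j" for i j
  proof
    assume "xvar i = xvar j"
    then have "Poly_Mapping.single (VX i) 1 = (Poly_Mapping.single (VX j) 1 :: var \<Rightarrow>\<^sub>0 nat)"
      by (metis keys_single one_neq_zero pvar_def singleton_inject)
    then have "VX i = VX j" by (metis keys_single one_neq_zero singleton_inject)
    with that show False by simp
  qed
  moreover have "finite {(i, j). 1 \<le> i \<and> i < j \<and> j \<le> n}"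
    by (rule finite_subset[of _ "{1..n} \<times> {1..n}"]) auto
  ultimately show ?thesis unfolding vandermonde_prod_def by (subst prod_zero_iff) auto
qed

theorem theorem1p4:
  fixes n N :: nat and lam :: "nat \<Rightarrow> nat"
  assumes "1 \<le> n"
    and "is_partition n lam"
    and "n + lam 1 \<le> N"
  shows "(groth N beta xvar (grassmannian_perm N n lam) =
            det1 n (\<lambda>i j. beta_complete_hom n beta xvar (int (lam j) + int i) j) \<and>
          to_fract (det1 n (\<lambda>i j. beta_complete_hom n beta xvar (int (lam j) + int i) j)) =
            to_fract (det1 n (\<lambda>i j. xvar i ^ (lam j + n - j) * (1 + beta * xvar i) ^ (j - 1)))
              / to_fract (vandermonde_prod n xvar)) \<and>
         to_fract (double_groth N beta xvar yvar (grassmannian_perm N n lam)) =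
            to_fract (det1 n (\<lambda>i j.
                (\<Prod>a = 1..lam j + n - j. xvar i + yvar a + beta * xvar i * yvar a)
                  * (1 + beta * xvar i) ^ (j - 1)))
              / to_fract (vandermonde_prod n xvar)"
proof -
  let ?w = "grassmannian_perm N n lam"
  let ?V = "vandermonde_prod n xvar"
  let ?H = "det1 n (\<lambda>i j. beta_complete_hom n beta xvar (int (lam j) + int i) j)"
  let ?D = "det1 n (\<lambda>i j. xvar i ^ (lam j + n - j) * (1 + beta * xvar i) ^ (j - 1))"
  note w = grassmannian_perm_props[OF assms(2,3)]
  have n: "n \<le> N" using assms(3) by simp
  have double: "double_groth N beta xvar y ?w * ?V =
      det1 n (\<lambda>i j. (\<Prod>a = 1..lam j + n - j. xvar i + y a + beta * xvar i * y a) * (1 + beta * xvar i) ^ (j - 1))"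
    for y
    unfolding double_groth_grassmannian[OF w(1) n one_plus_beta_xvar_nonzero]
  proof (rule det1_cong)
    fix i j assume j: "j \<in> {1..n}"
    have "?w (n + 1 - j) = n + 1 - j + lam (n + 1 - (n + 1 - j))"
      by (rule w(2)) (use j in auto)
    also have "\<dots> = Suc (lam j + n - j)" using j by auto
    finally have "{1..<?w (n + 1 - j)} = {1..lam j + n - j}" by auto
    then show "(\<Prod>a=1..<?w (n + 1 - j). xvar i + y a + beta * xvar i * y a) * (1 + beta * xvar i) ^ (j - 1) =
      (\<Prod>a=1..lam j + n - j. xvar i + y a + beta * xvar i * y a) * (1 + beta * xvar i) ^ (j - 1)"
      by (simp only:)
  qed
  have single: "groth N beta xvar ?w * ?V = ?D"
    using double[of "\<lambda>_. 0"] by (simp add: groth_eq_double_groth)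
  have JT: "?H * ?V = ?D" by (rule det1_beta_complete_hom)
  have quot: "to_fract a = to_fract d / to_fract ?V" if "a * ?V = d" for a d
    using that vandermonde_prod_xvar_nonzero[of n] by (auto simp: nonzero_eq_divide_eq)
  have "groth N beta xvar ?w * ?V = ?H * ?V" by (simp only: single JT)
  then have "groth N beta xvar ?w = ?H"
    by (rule mult_right_cancel[OF vandermonde_prod_xvar_nonzero, THEN iffD1])
  then show ?thesis
    by (intro conjI quot JT double)
qed

end
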